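(* Let $q$ be a prime power and $2\le k\le r$, $m\ge1$ integers with $c:=\frac mr\binom rk\in\mathbb Z$, and $N=r+c$. Put $L_r=\frac{q^{r+1}-1}{q-1}$ and $$A_r=(r+1)\left(1+\frac{(k-1)c}{r+1-k}\right).$$ Then $$\mathbb E X_{N,r+1}\le C_q\,q^{-A_r}.$$ Moreover, for every integer $2\le t\le L_r/2$, $$\log_q\mathbb E(X_{N,r})_t\ge tr-A_r-O(t),$$ where the implied constant is absolute (uniform in $q,k,r,m,t$). Consequently: (i) if $k=2$ and $m$ is fixed, then for every fixed integer $t>(m+2)/2$ one has $\mathbb E(X_{N,r})_t\to\infty$ as $r\to\infty$ along such parameters; (ii) fix $k\ge3$ and allow $m=m(r)\ge1$ to vary. For every $\varepsilon>0$, for all sufficiently large $r$ (in terms of $k,\varepsilon$), if $$t\ge\left(\frac{k-1}{k!}+\varepsilon\right)mr^{k-2},\qquad t\le L_r/2,$$ then, uniformly in $q$, $$\frac{\mathbb E(X_{N,r})_t}{\mu_{N,r}^t}\ge q^{(\varepsilon/2)mr^{k-1}}\longrightarrow\infty .$$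
   Context: Let $V_N=\mathbb F_q^N$ and let $\Theta_N$ be uniformly random in $\mathrm{Hom}(\Lambda^kV_N,\mathbb F_q^m)$. A subspace $H\le V_N$ is null if $\Theta_N(\Lambda^kH)=0$. For an integer $s$, $X_{N,s}$ is the number of $s$-dimensional null subspaces; $\mu_{N,r}=\mathbb E X_{N,r}$. $(X)_t=X(X-1)\cdots(X-t+1)$ is the falling factorial. $C_q=\prod_{j\ge1}(1-q^{-j})^{-1}$. *)

theory Defs
  imports
    "Jordan_Normal_Form.Missing_VectorSpace"
    "HOL-Probability.Probability"
begin

text \<open>
  Finite fields are records of HOL-Algebra rather than types, so that constants can be
  quantified before the field and hence be uniform in it.  Every finite field is isomorphic to
  one whose carrier is a set of natural numbers, so \<open>F :: nat ring\<close> covers all of them.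
\<close>

definition finite_field :: "('a, 'b) ring_scheme \<Rightarrow> bool" where
  "finite_field F \<longleftrightarrow> field F \<and> finite (carrier F)"

abbreviation coord_space :: "('a, 'b) ring_scheme \<Rightarrow> nat \<Rightarrow> ('a, nat \<Rightarrow> 'a) module" where
  "coord_space F n \<equiv> ring.func_space F {..<n}"

definition subspaces_dim ::
    "('a, 'b) ring_scheme \<Rightarrow> ('a, 'c, 'd) module_scheme \<Rightarrow> nat \<Rightarrow> 'c set set" where
  "subspaces_dim F V s =
     {H. VectorSpace.subspace F H V \<and> vectorspace.dim F (V\<lparr>carrier := H\<rparr>) = s}"

text \<open>
  The library has no exterior powers.  The \<open>k\<close>-th exterior power of \<open>F\<^sup>N\<close> is modelled by
  coordinates with respect to the standard basis
  \<open>e\<^sub>I = e\<^bsub>i(0)\<^esub> \<and> \<dots> \<and> e\<^bsub>i(k-1)\<^esub>\<close>, where \<open>I = {i(0) < \<dots> < i(k-1)}\<close> runs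
  through the \<open>k\<close>-subsets of \<open>{..<N}\<close>.  The \<open>I\<close>-coordinate of \<open>v\<^sub>0 \<and> \<dots> \<and> v\<^bsub>k-1\<^esub>\<close> is the
  minor of the matrix with rows \<open>v\<^sub>j\<close> on the columns in \<open>I\<close>, written with the Leibniz formula.
\<close>

definition k_subsets :: "nat \<Rightarrow> nat \<Rightarrow> nat set set" where
  "k_subsets N k = {I. I \<subseteq> {..<N} \<and> card I = k}"

abbreviation ext_power :: "('a, 'b) ring_scheme \<Rightarrow> nat \<Rightarrow> nat \<Rightarrow> ('a, nat set \<Rightarrow> 'a) module" where
  "ext_power F k N \<equiv> ring.func_space F (k_subsets N k)"

definition perm_sign :: "('a, 'b) ring_scheme \<Rightarrow> (nat \<Rightarrow> nat) \<Rightarrow> 'a" where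
  "perm_sign F \<sigma> = (if evenperm \<sigma> then \<one>\<^bsub>F\<^esub> else \<ominus>\<^bsub>F\<^esub> \<one>\<^bsub>F\<^esub>)"

definition wedge ::
    "('a, 'b) ring_scheme \<Rightarrow> nat \<Rightarrow> nat \<Rightarrow> (nat \<Rightarrow> nat \<Rightarrow> 'a) \<Rightarrow> nat set \<Rightarrow> 'a" where
  "wedge F k N v =
     (\<lambda>I\<in>k_subsets N k.
        \<Oplus>\<^bsub>F\<^esub>\<sigma>\<in>{\<sigma>. \<sigma> permutes {..<k}}.
          perm_sign F \<sigma> \<otimes>\<^bsub>F\<^esub> (\<Otimes>\<^bsub>F\<^esub>j\<in>{..<k}. v j (sorted_list_of_set I ! \<sigma> j)))"

text \<open>
  For a subspace \<open>H\<close> of \<open>F\<^sup>N\<close>, the exterior power of \<open>H\<close> as a subspace of the exterior power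
  of \<open>F\<^sup>N\<close>.
\<close>

definition ext_power_sub ::
    "('a, 'b) ring_scheme \<Rightarrow> nat \<Rightarrow> nat \<Rightarrow> (nat \<Rightarrow> 'a) set \<Rightarrow> (nat set \<Rightarrow> 'a) set" where
  "ext_power_sub F k N H =
     LinearCombinations.module.span F (ext_power F k N) {wedge F k N v |v. \<forall>j<k. v j \<in> H}"

text \<open>
  Linear maps are taken extensional, i.e. with a fixed value outside the carrier of the domain,
  so that each linear map is counted exactly once.
\<close>

definition lin_maps ::
    "('a, 'b) ring_scheme \<Rightarrow> ('a, 'c, 'd) module_scheme \<Rightarrow> ('a, 'e, 'f) module_scheme \<Rightarrow> ('c \<Rightarrow> 'e) set"
  where "lin_maps F V W = LinearCombinations.module_hom F V W \<inter> extensional (carrier V)"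

definition random_map ::
    "('a, 'b) ring_scheme \<Rightarrow> nat \<Rightarrow> nat \<Rightarrow> nat \<Rightarrow> ((nat set \<Rightarrow> 'a) \<Rightarrow> nat \<Rightarrow> 'a) pmf" where
  "random_map F k m N = pmf_of_set (lin_maps F (ext_power F k N) (coord_space F m))"

definition null_subspace ::
    "('a, 'b) ring_scheme \<Rightarrow> nat \<Rightarrow> nat \<Rightarrow> nat \<Rightarrow> ((nat set \<Rightarrow> 'a) \<Rightarrow> nat \<Rightarrow> 'a) \<Rightarrow> (nat \<Rightarrow> 'a) set \<Rightarrow> bool"
  where "null_subspace F k m N \<Theta> H \<longleftrightarrow>
     (\<forall>w\<in>ext_power_sub F k N H. \<Theta> w = \<zero>\<^bsub>coord_space F m\<^esub>)"

definition num_null ::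
    "('a, 'b) ring_scheme \<Rightarrow> nat \<Rightarrow> nat \<Rightarrow> nat \<Rightarrow> nat \<Rightarrow> ((nat set \<Rightarrow> 'a) \<Rightarrow> nat \<Rightarrow> 'a) \<Rightarrow> nat" where
  "num_null F k m N s \<Theta> =
     card {H \<in> subspaces_dim F (coord_space F N) s. null_subspace F k m N \<Theta> H}"

definition falling_factorial :: "real \<Rightarrow> nat \<Rightarrow> real" where
  "falling_factorial x t = (\<Prod>i<t. x - real i)"

definition mean_null :: "('a, 'b) ring_scheme \<Rightarrow> nat \<Rightarrow> nat \<Rightarrow> nat \<Rightarrow> nat \<Rightarrow> real" where
  "mean_null F k m N s =
     measure_pmf.expectation (random_map F k m N) (\<lambda>\<Theta>. real (num_null F k m N s \<Theta>))"

definition factorial_moment_null ::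
    "('a, 'b) ring_scheme \<Rightarrow> nat \<Rightarrow> nat \<Rightarrow> nat \<Rightarrow> nat \<Rightarrow> nat \<Rightarrow> real" where
  "factorial_moment_null F k m N s t =
     measure_pmf.expectation (random_map F k m N)
       (\<lambda>\<Theta>. falling_factorial (real (num_null F k m N s \<Theta>)) t)"

definition C_const :: "real \<Rightarrow> real" where
  "C_const q = (\<Prod>j. inverse (1 - q powr - real (Suc j)))"

definition L_const :: "real \<Rightarrow> nat \<Rightarrow> real" where
  "L_const q r = (q ^ (r + 1) - 1) / (q - 1)"

definition A_const :: "nat \<Rightarrow> nat \<Rightarrow> nat \<Rightarrow> real" where
  "A_const k c r = (real r + 1) * (1 + (real k - 1) * real c / (real r + 1 - real k))"

text \<open>Taking \<open>c\<close> in \<open>nat\<close> expresses integrality of \<open>(m/r) binom(r,k)\<close>, which is never negative.\<close>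

definition admissible :: "nat \<Rightarrow> nat \<Rightarrow> nat \<Rightarrow> nat \<Rightarrow> bool" where
  "admissible k r m c \<longleftrightarrow>
     2 \<le> k \<and> k \<le> r \<and> 1 \<le> m \<and> real c = real m / real r * real (r choose k)"

end

theory Submission
  imports Defs
begin

text \<open>
  A null \<open>(r + 1)\<close>-space \<open>W\<close> contains \<open>L\<^sub>r\<close> hyperplanes, all of them null, and \<open>W\<close> is determined by any
  two of these.  Hence \<open>(X\<^bsub>N,r\<^esub>)\<^sub>t \<ge> X\<^bsub>N,r+1\<^esub> (L\<^sub>r)\<^sub>t\<close> pointwise for \<open>t \<ge> 2\<close>, and
  \<open>(L\<^sub>r)\<^sub>t \<ge> (L\<^sub>r / 2)\<^sup>t \<ge> q\<^bsup>tr-t\<^esup>\<close>.  An \<open>s\<close>-dimensional space is null with probability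
  \<open>q\<^bsup>-m binom(s,k)\<^esup>\<close>, so \<open>\<mu>\<^bsub>N,s\<^esub>\<close> is a Gaussian binomial coefficient times this power; it is of order
  \<open>1\<close> for \<open>s = r\<close> and \<open>q\<^bsup>-A\<^esup>\<close> with \<open>A = A\<^sub>r\<close> for \<open>s = r + 1\<close>.

  Linear algebra is done in coordinates: a subspace \<open>H\<close> of a function space has a set \<open>P\<close> of
  pivots, i.e. coordinates on which \<open>H\<close> restricts isomorphically, with a basis dual to them.  The
  wedges of the \<open>k\<close>-subsets of a dual basis of \<open>H\<close> form the dual basis of \<open>\<Lambda>\<^sup>kH\<close> at the
  pivots \<open>{J \<subseteq> P. card J = k}\<close>, which gives its dimension.
\<close>

section \<open>Subspaces of coordinate spaces\<close>

text \<open>The factor q^(-A_r) is paid once, for the presence of a single null (r+1)-space, while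
  each of the t hyperplanes in a tuple gains a factor of order q^r. The factorial moment is
  therefore large as soon as t r exceeds A_r by more than a loss of O(t), although the mean of
  X_{N,r} stays bounded: N = r + c is chosen so that the exponent r(N-r) - m binom(r,k) is zero. For
  k = 2 one has c = m(r-1)/2 and A_r = (r+1)(m+2)/2, whence the threshold (m+2)/2. For k >= 3 the
  leading term of the upper bound for A_r is m r^(k-1) (k-1)/k!, whence the constant in (ii).
  Uniformity in q comes from two absolute bounds, namely 4 <= q^2 for the partial products of C_q
  and L_r/2 >= q^(r-1): every loss is a fixed number of powers of q per tuple entry. Dimension
  enters the counting through cardinality, since |H| = q^s already says dim H = s.\<close>

lemma (in vectorspace) card_carrier_eq_power_dim:
  assumes "finite (carrier K)" "finite (carrier V)"
  shows "card (carrier V) = card (carrier K) ^ dim"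
proof -
  have "gen_set (carrier V)"
    using in_own_span span_is_subset2 by blast
  then have "fin_dim"
    unfolding fin_dim_def using assms by blast
  then obtain A where A: "finite A" "basis A"
    using finite_basis_exists by blast
  then have AC: "A \<subseteq> carrier V" by (simp add: basis_def)
  have *: "\<exists>!a. a \<in> A \<rightarrow>\<^sub>E carrier K \<and> lincomb a A = v" if "v \<in> carrier V" for v
    using basis_criterion[OF A(1) AC] A(2) that by blast
  have "bij_betw (\<lambda>a. lincomb a A) (A \<rightarrow>\<^sub>E carrier K) (carrier V)"
  proof (rule bij_betw_imageI)
    show "inj_on (\<lambda>a. lincomb a A) (A \<rightarrow>\<^sub>E carrier K)"
    proof (rule inj_onI)
      fix a b assume ab: "a \<in> A \<rightarrow>\<^sub>E carrier K" "b \<in> A \<rightarrow>\<^sub>E carrier K" "lincomb a A = lincomb b A"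
      have "lincomb a A \<in> carrier V"
        using AC ab(1) by (intro lincomb_closed) (auto simp: PiE_def)
      from *[OF this] ab show "a = b" by metis
    qed
    show "(\<lambda>a. lincomb a A) ` (A \<rightarrow>\<^sub>E carrier K) = carrier V"
    proof
      show "(\<lambda>a. lincomb a A) ` (A \<rightarrow>\<^sub>E carrier K) \<subseteq> carrier V"
        using AC by (auto intro!: lincomb_closed simp: PiE_def)
      show "carrier V \<subseteq> (\<lambda>a. lincomb a A) ` (A \<rightarrow>\<^sub>E carrier K)"
        using * by (metis (no_types, lifting) image_iff subsetI)
    qed
  qed
  then have "card (carrier V) = card (A \<rightarrow>\<^sub>E carrier K)"
    by (simp add: bij_betw_same_card)
  then show ?thesis
    using A dim_basis by (simp add: card_funcsetE)
qed

locale fin_field = field F for F (structure) +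
  assumes finite_carrier: "finite (carrier F)"
begin

abbreviation "q \<equiv> card (carrier F)"

abbreviation Fn where "Fn \<equiv> func_space"

lemma q_ge_2: "q \<ge> 2"
proof -
  have "card {\<zero>, \<one>} \<le> q"
    using finite_carrier by (intro card_mono) auto
  then show ?thesis by simp
qed

lemma vectorspace_Fn: "vectorspace F (Fn S)"
  using func_space_is_module[of S] field_axioms
  by (simp add: vectorspace_def module_def)

lemma carrier_Fn: "carrier (Fn S) = S \<rightarrow>\<^sub>E carrier F"
  and zero_Fn: "\<zero>\<^bsub>Fn S\<^esub> = (\<lambda>i\<in>S. \<zero>)"
  and add_Fn: "x \<oplus>\<^bsub>Fn S\<^esub> y = (\<lambda>i\<in>S. x i \<oplus> y i)"
  and smult_Fn: "a \<odot>\<^bsub>Fn S\<^esub> x = (\<lambda>i\<in>S. a \<otimes> x i)"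
  by (simp_all add: func_space_def)

lemma finite_carrier_Fn: "finite S \<Longrightarrow> finite (carrier (Fn S))"
  by (simp add: carrier_Fn finite_PiE finite_carrier)

lemma card_carrier_Fn: "finite S \<Longrightarrow> card (carrier (Fn S)) = q ^ card S"
  by (simp add: carrier_Fn card_funcsetE)

text \<open>A subspace of dimension d has q^d elements and q \<ge> 2, so its cardinality determines
  d. Membership becomes closure plus a count, and later arguments need not mention
  \<open>vectorspace.dim\<close>.\<close>

lemma subspaces_dim_Fn:
  assumes "finite S"
  shows "subspaces_dim F (Fn S) s = {H. submodule F H (Fn S) \<and> card H = q ^ s}"
proof -
  interpret V: vectorspace F "Fn S" by (rule vectorspace_Fn)
  have "vectorspace.dim F ((Fn S)\<lparr>carrier := H\<rparr>) = s \<longleftrightarrow> card H = q ^ s"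
    if H: "submodule F H (Fn S)" for H
  proof -
    have "VectorSpace.subspace F H (Fn S)"
      using H by (simp add: VectorSpace.subspace_def vectorspace_Fn)
    then interpret W: vectorspace F "(Fn S)\<lparr>carrier := H\<rparr>"
      by (rule V.subspace_is_vs)
    have "H \<subseteq> carrier (Fn S)" using H by (simp add: submodule_def)
    then have "finite H" using finite_carrier_Fn[OF assms] finite_subset by blast
    then have "card H = q ^ W.dim"
      using W.card_carrier_eq_power_dim finite_carrier by simp
    then show ?thesis using q_ge_2 by (simp add: power_inject_exp)
  qed
  then show ?thesis
    unfolding subspaces_dim_def VectorSpace.subspace_def using vectorspace_Fn by blast
qed

lemma submodule_FnD:
  assumes "submodule F H (Fn S)"
  shows "H \<subseteq> carrier (Fn S)"
    and "\<zero>\<^bsub>Fn S\<^esub> \<in> H"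
    and "x \<in> H \<Longrightarrow> y \<in> H \<Longrightarrow> x \<oplus>\<^bsub>Fn S\<^esub> y \<in> H"
    and "a \<in> carrier F \<Longrightarrow> x \<in> H \<Longrightarrow> a \<odot>\<^bsub>Fn S\<^esub> x \<in> H"
  using assms by (simp_all add: submodule_def)

lemma submodule_FnI:
  assumes "H \<subseteq> carrier (Fn S)"
    and "\<zero>\<^bsub>Fn S\<^esub> \<in> H"
    and "\<And>x y. x \<in> H \<Longrightarrow> y \<in> H \<Longrightarrow> x \<oplus>\<^bsub>Fn S\<^esub> y \<in> H"
    and "\<And>a x. a \<in> carrier F \<Longrightarrow> x \<in> H \<Longrightarrow> a \<odot>\<^bsub>Fn S\<^esub> x \<in> H"
  shows "submodule F H (Fn S)"
  using assms func_space_is_module[of S] by (simp add: submodule_def)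

lemma finite_submodule: "submodule F H (Fn S) \<Longrightarrow> finite S \<Longrightarrow> finite H"
  using finite_carrier_Fn finite_subset submodule_FnD(1) by metis

lemma submodule_minus:
  assumes "submodule F H (Fn S)" "x \<in> H" "y \<in> H"
  shows "x \<ominus>\<^bsub>Fn S\<^esub> y \<in> H"
proof -
  interpret V: vectorspace F "Fn S" by (rule vectorspace_Fn)
  note D = submodule_FnD[OF assms(1)]
  have "y \<in> carrier (Fn S)" using D(1) assms(3) by blast
  then have "\<ominus>\<^bsub>Fn S\<^esub> y = (\<ominus> \<one>) \<odot>\<^bsub>Fn S\<^esub> y"
    by (simp add: V.smult_l_minus)
  then have "\<ominus>\<^bsub>Fn S\<^esub> y \<in> H" using D(4)[of "\<ominus> \<one>" y] assms(3) by simp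
  then show ?thesis using D(3) assms(2) by (simp add: a_minus_def)
qed

lemma submodule_finsum:
  assumes H: "submodule F H (Fn S)" and f: "\<And>p. p \<in> P \<Longrightarrow> f p \<in> H"
  shows "(\<Oplus>\<^bsub>Fn S\<^esub>p\<in>P. f p) \<in> H"
  using f
proof (induction P rule: infinite_finite_induct)
  interpret V: vectorspace F "Fn S" by (rule vectorspace_Fn)
  note D = submodule_FnD[OF H]
  case (insert p P)
  moreover have "f p \<in> carrier (Fn S)" "f \<in> P \<rightarrow> carrier (Fn S)"
    using insert.prems D(1) by auto
  ultimately show ?case
    using D(3) by (subst V.finsum_insert) auto
next
  interpret V: vectorspace F "Fn S" by (rule vectorspace_Fn)
  note D = submodule_FnD[OF H]
  { case (infinite P) then show ?case using D(2) by simp }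
  { case empty then show ?case using D(2) by simp }
qed

lemma finsum_Fn_apply:
  assumes "f \<in> P \<rightarrow> carrier (Fn S)" "i \<in> S" "finite P"
  shows "(\<Oplus>\<^bsub>Fn S\<^esub>p\<in>P. f p) i = (\<Oplus>p\<in>P. f p i)"
  using assms(3,1)
proof (induction P)
  interpret V: vectorspace F "Fn S" by (rule vectorspace_Fn)
  case empty
  show ?case using assms(2) by (simp add: zero_Fn)
next
  interpret V: vectorspace F "Fn S" by (rule vectorspace_Fn)
  case (insert p P)
  have c: "f p \<in> carrier (Fn S)" "f \<in> P \<rightarrow> carrier (Fn S)" using insert.prems by auto
  moreover have "(\<lambda>p. f p i) \<in> P \<rightarrow> carrier F" "f p i \<in> carrier F"
    using c assms(2) by (auto simp: carrier_Fn Pi_iff PiE_iff)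
  ultimately show ?case
    using insert assms(2) by (simp add: V.finsum_insert add_Fn)
qed

lemma finsum_delta:
  assumes "finite P" "j \<in> P" "a \<in> carrier F" "\<And>p. p \<in> P \<Longrightarrow> f p = (if p = j then a else \<zero>)"
  shows "(\<Oplus>p\<in>P. f p) = a"
proof -
  have "(\<Oplus>p\<in>P. f p) = (\<Oplus>p\<in>P. if j = p then a else \<zero>)"
    by (rule finsum_cong') (use assms in auto)
  also have "\<dots> = a"
    using finsum_singleton[of j P "\<lambda>_. a"] assms by auto
  finally show ?thesis .
qed

text \<open>This is reduced row echelon form without an order on the coordinates: \<open>P\<close>
  is the set of pivot columns and the \<open>b p\<close> are the rows. The last clause says that
  restriction to \<open>P\<close> has trivial kernel on \<open>H\<close>.\<close>

definition pivots :: "'z set \<Rightarrow> ('z \<Rightarrow> 'a) set \<Rightarrow> 'z set \<Rightarrow> ('z \<Rightarrow> 'z \<Rightarrow> 'a) \<Rightarrow> bool" where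
  "pivots S H P b \<longleftrightarrow> P \<subseteq> S \<and>
     (\<forall>p\<in>P. b p \<in> H \<and> (\<forall>p'\<in>P. b p p' = (if p' = p then \<one> else \<zero>))) \<and>
     (\<forall>h\<in>H. (\<forall>p\<in>P. h p = \<zero>) \<longrightarrow> h = \<zero>\<^bsub>Fn S\<^esub>)"

text \<open>A minimal set of coordinates separating the points of \<open>H\<close> carries a dual basis.\<close>

lemma pivots_exist:
  assumes H: "submodule F H (Fn S)" and S: "finite S"
  obtains P b where "pivots S H P b"
proof -
  note D = submodule_FnD[OF H]
  define sep where "sep P \<longleftrightarrow> P \<subseteq> S \<and> (\<forall>h\<in>H. (\<forall>p\<in>P. h p = \<zero>) \<longrightarrow> h = \<zero>\<^bsub>Fn S\<^esub>)" for P
  have "h = \<zero>\<^bsub>Fn S\<^esub>" if "h \<in> H" "\<forall>p\<in>S. h p = \<zero>" for h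
    using that D(1) by (intro PiE_ext[of _ S "\<lambda>_. carrier F"]) (auto simp: zero_Fn carrier_Fn)
  then have "sep S" by (auto simp: sep_def)
  then obtain P where P: "sep P" and Pmin: "\<And>P'. sep P' \<Longrightarrow> card P \<le> card P'"
    using ex_has_least_nat[of sep S card] by blast
  have PS: "P \<subseteq> S" using P by (simp add: sep_def)
  have finP: "finite P" using PS S finite_subset by blast
  have "\<exists>x\<in>H. \<forall>p'\<in>P. x p' = (if p' = p then \<one> else \<zero>)" if p: "p \<in> P" for p
  proof -
    \<comment> \<open>By minimality some nonzero h in \<open>H\<close> vanishes on
      \<open>P - {p}\<close>. As \<open>P\<close> itself separates, h is nonzero at p and can be
      scaled to the dual vector.\<close>
    have "card (P - {p}) < card P" using p finP by (meson card_Diff1_less)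
    then have "\<not> sep (P - {p})" using Pmin leD by blast
    then obtain h where h: "h \<in> H" "\<forall>p'\<in>P - {p}. h p' = \<zero>" "h \<noteq> \<zero>\<^bsub>Fn S\<^esub>"
      using PS by (auto simp: sep_def)
    have "h p \<noteq> \<zero>" using P h p by (auto simp: sep_def)
    moreover have "h p \<in> carrier F"
      using h(1) D(1) p PS by (auto simp: carrier_Fn PiE_iff)
    ultimately have hp: "h p \<in> Units F" using field_Units by auto
    have "\<forall>p'\<in>P. (inv (h p) \<odot>\<^bsub>Fn S\<^esub> h) p' = (if p' = p then \<one> else \<zero>)"
      using h(2) hp PS by (auto simp: smult_Fn Units_l_inv)
    moreover have "inv (h p) \<odot>\<^bsub>Fn S\<^esub> h \<in> H"
      using D(4) h(1) hp by blast
    ultimately show ?thesis by blast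
  qed
  then obtain b where "\<forall>p\<in>P. b p \<in> H \<and> (\<forall>p'\<in>P. b p p' = (if p' = p then \<one> else \<zero>))"
    by metis
  then have "pivots S H P b" using P by (simp add: pivots_def sep_def)
  then show ?thesis by (rule that)
qed

definition pivot_comb :: "'z set \<Rightarrow> 'z set \<Rightarrow> ('z \<Rightarrow> 'z \<Rightarrow> 'a) \<Rightarrow> ('z \<Rightarrow> 'a) \<Rightarrow> 'z \<Rightarrow> 'a" where
  "pivot_comb S P b a = (\<Oplus>\<^bsub>Fn S\<^esub>p\<in>P. a p \<odot>\<^bsub>Fn S\<^esub> b p)"

context
  fixes S :: "'z set" and H P b
  assumes H: "submodule F H (Fn S)" and S: "finite S" and P: "pivots S H P b"
begin

lemma pivot_subset: "P \<subseteq> S" and pivot_finite: "finite P"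
  and pivot_mem: "p \<in> P \<Longrightarrow> b p \<in> H"
  and pivot_delta: "p \<in> P \<Longrightarrow> p' \<in> P \<Longrightarrow> b p p' = (if p' = p then \<one> else \<zero>)"
  and pivot_sep: "h \<in> H \<Longrightarrow> (\<And>p. p \<in> P \<Longrightarrow> h p = \<zero>) \<Longrightarrow> h = \<zero>\<^bsub>Fn S\<^esub>"
  using P S finite_subset unfolding pivots_def by (blast, blast, blast, meson, meson)

lemma pivot_comb_mem:
  assumes "\<And>p. p \<in> P \<Longrightarrow> a p \<in> carrier F"
  shows "pivot_comb S P b a \<in> H"
  unfolding pivot_comb_def
  by (intro submodule_finsum[OF H] submodule_FnD(4)[OF H] assms pivot_mem)

lemma pivot_comb_apply:
  assumes a: "\<And>p. p \<in> P \<Longrightarrow> a p \<in> carrier F" and j: "j \<in> P"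
  shows "pivot_comb S P b a j = a j"
proof -
  interpret V: vectorspace F "Fn S" by (rule vectorspace_Fn)
  have c: "b p \<in> carrier (Fn S)" if "p \<in> P" for p
    using submodule_FnD(1)[OF H] pivot_mem that by blast
  have "pivot_comb S P b a j = (\<Oplus>p\<in>P. (a p \<odot>\<^bsub>Fn S\<^esub> b p) j)"
    unfolding pivot_comb_def
    by (rule finsum_Fn_apply) (use a c j pivot_subset pivot_finite in auto)
  also have "\<dots> = a j"
    using j pivot_subset a
    by (intro finsum_delta[OF pivot_finite j]) (auto simp: smult_Fn pivot_delta)
  finally show ?thesis .
qed

lemma pivot_ext:
  assumes "x \<in> H" "y \<in> H" "\<And>p. p \<in> P \<Longrightarrow> x p = y p"
  shows "x = y"
proof -
  interpret V: vectorspace F "Fn S" by (rule vectorspace_Fn)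
  have c: "x \<in> carrier (Fn S)" "y \<in> carrier (Fn S)"
    using submodule_FnD(1)[OF H] assms by blast+
  then have n: "\<ominus>\<^bsub>Fn S\<^esub> y = (\<ominus> \<one>) \<odot>\<^bsub>Fn S\<^esub> y"
    by (simp add: V.smult_l_minus)
  have "x \<ominus>\<^bsub>Fn S\<^esub> y = \<zero>\<^bsub>Fn S\<^esub>"
  proof (rule pivot_sep[OF submodule_minus[OF H assms(1,2)]])
    fix p assume p: "p \<in> P"
    then have "p \<in> S" "y p \<in> carrier F" using pivot_subset c by (auto simp: carrier_Fn)
    then show "(x \<ominus>\<^bsub>Fn S\<^esub> y) p = \<zero>"
      using assms(3)[OF p] by (simp add: a_minus_def n add_Fn smult_Fn l_minus r_neg)
  qed
  then have "\<ominus>\<^bsub>Fn S\<^esub> (\<ominus>\<^bsub>Fn S\<^esub> y) = x"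
    using c by (intro V.minus_equality) (simp_all add: a_minus_def)
  then show ?thesis using c by simp
qed

lemma pivot_expand:
  assumes "h \<in> H"
  shows "pivot_comb S P b h = h"
proof -
  have "h p \<in> carrier F" if "p \<in> P" for p
    using submodule_FnD(1)[OF H] assms that pivot_subset by (auto simp: carrier_Fn PiE_iff)
  then show ?thesis
    using assms by (intro pivot_ext pivot_comb_mem pivot_comb_apply) auto
qed

text \<open>Restriction to \<open>P\<close> has the inverse \<open>pivot_comb\<close>: the dual
  basis realises any prescribed values at the pivots, and by separation these values determine the
  vector.\<close>

lemma card_pivots: "card H = q ^ card P"
proof -
  have HF: "h p \<in> carrier F" if "h \<in> H" "p \<in> P" for h p
    using submodule_FnD(1)[OF H] that pivot_subset by (auto simp: carrier_Fn PiE_iff)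
  have "bij_betw (\<lambda>h. restrict h P) H (P \<rightarrow>\<^sub>E carrier F)"
  proof (rule bij_betwI[where g = "pivot_comb S P b"])
    show "restrict (pivot_comb S P b a) P = a" if "a \<in> P \<rightarrow>\<^sub>E carrier F" for a
    proof
      fix p show "restrict (pivot_comb S P b a) P p = a p"
        using that by (cases "p \<in> P") (auto intro!: pivot_comb_apply)
    qed
    show "pivot_comb S P b (restrict h P) = h" if "h \<in> H" for h
      using that HF by (intro pivot_ext pivot_comb_mem) (auto simp: pivot_comb_apply)
    show "pivot_comb S P b \<in> (P \<rightarrow>\<^sub>E carrier F) \<rightarrow> H"
      by (auto intro!: pivot_comb_mem)
  qed (use HF in auto)
  then have "card H = card (P \<rightarrow>\<^sub>E carrier F)" by (rule bij_betw_same_card)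
  then show ?thesis using pivot_finite by (simp add: card_funcsetE)
qed

end

text \<open>Meant for intersections of subspaces, whose dimension is not known in advance: having
  more than q^r elements then forces at least q^(r+1).\<close>

lemma card_submodule:
  assumes "submodule F H (Fn S)" "finite S"
  obtains s where "card H = q ^ s"
  using pivots_exist[OF assms] card_pivots[OF assms] by metis

end

section \<open>Counting subspaces\<close>

context fin_field begin

definition adjoin :: "'z set \<Rightarrow> ('z \<Rightarrow> 'a) \<Rightarrow> ('z \<Rightarrow> 'a) set \<Rightarrow> ('z \<Rightarrow> 'a) set" where
  "adjoin S x H = (\<lambda>(a, h). a \<odot>\<^bsub>Fn S\<^esub> x \<oplus>\<^bsub>Fn S\<^esub> h) ` (carrier F \<times> H)"

lemma adjoin_mono:
  assumes "submodule F W (Fn S)" "H \<subseteq> W" "x \<in> W"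
  shows "adjoin S x H \<subseteq> W"
  using assms(2,3) submodule_FnD(3,4)[OF assms(1)] by (auto simp: adjoin_def)

lemma submodule_adjoin:
  assumes H: "submodule F H (Fn S)" and x: "x \<in> carrier (Fn S)"
  shows "submodule F (adjoin S x H) (Fn S)"
proof -
  interpret V: vectorspace F "Fn S" by (rule vectorspace_Fn)
  note D = submodule_FnD[OF H]
  have HC: "h \<in> carrier (Fn S)" if "h \<in> H" for h using that D(1) by blast
  show ?thesis
  proof (rule submodule_FnI)
    show "adjoin S x H \<subseteq> carrier (Fn S)"
      using x D(1) by (auto simp: adjoin_def)
    show "\<zero>\<^bsub>Fn S\<^esub> \<in> adjoin S x H"
      unfolding adjoin_def by (rule image_eqI[of _ _ "(\<zero>, \<zero>\<^bsub>Fn S\<^esub>)"]) (use x D(2) in auto)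
  next
    fix v w assume "v \<in> adjoin S x H" "w \<in> adjoin S x H"
    then obtain a h a' h' where *: "a \<in> carrier F" "a' \<in> carrier F" "h \<in> H" "h' \<in> H"
      "v = a \<odot>\<^bsub>Fn S\<^esub> x \<oplus>\<^bsub>Fn S\<^esub> h" "w = a' \<odot>\<^bsub>Fn S\<^esub> x \<oplus>\<^bsub>Fn S\<^esub> h'"
      by (auto simp: adjoin_def)
    have "v \<oplus>\<^bsub>Fn S\<^esub> w = (a \<oplus> a') \<odot>\<^bsub>Fn S\<^esub> x \<oplus>\<^bsub>Fn S\<^esub> (h \<oplus>\<^bsub>Fn S\<^esub> h')"
      using * x HC by (simp add: V.smult_l_distr V.a_ac)
    then show "v \<oplus>\<^bsub>Fn S\<^esub> w \<in> adjoin S x H"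
      unfolding adjoin_def using * D(3)
      by (intro image_eqI[of _ _ "(a \<oplus> a', h \<oplus>\<^bsub>Fn S\<^esub> h')"]) auto
  next
    fix c v assume c: "c \<in> carrier F" and "v \<in> adjoin S x H"
    then obtain a h where *: "a \<in> carrier F" "h \<in> H" "v = a \<odot>\<^bsub>Fn S\<^esub> x \<oplus>\<^bsub>Fn S\<^esub> h"
      by (auto simp: adjoin_def)
    have "c \<odot>\<^bsub>Fn S\<^esub> v = (c \<otimes> a) \<odot>\<^bsub>Fn S\<^esub> x \<oplus>\<^bsub>Fn S\<^esub> c \<odot>\<^bsub>Fn S\<^esub> h"
      using * c x HC by (simp add: V.smult_r_distr V.smult_assoc1)
    then show "c \<odot>\<^bsub>Fn S\<^esub> v \<in> adjoin S x H"
      unfolding adjoin_def using * c D(4)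
      by (intro image_eqI[of _ _ "(c \<otimes> a, c \<odot>\<^bsub>Fn S\<^esub> h)"]) auto
  qed
qed

text \<open>The representation a x + h is unique: two of them with different scalars a, a' would,
  after division by a - a', put x into \<open>H\<close>.\<close>

lemma card_adjoin:
  assumes H: "submodule F H (Fn S)" and x: "x \<in> carrier (Fn S)" "x \<notin> H"
  shows "card (adjoin S x H) = q * card H"
proof -
  interpret V: vectorspace F "Fn S" by (rule vectorspace_Fn)
  note D = submodule_FnD[OF H]
  have HC: "h \<in> carrier (Fn S)" if "h \<in> H" for h using that D(1) by blast
  have "inj_on (\<lambda>(a, h). a \<odot>\<^bsub>Fn S\<^esub> x \<oplus>\<^bsub>Fn S\<^esub> h) (carrier F \<times> H)"
  proof (rule inj_onI, clarsimp)
    fix a h a' h' assume *: "a \<in> carrier F" "a' \<in> carrier F" "h \<in> H" "h' \<in> H"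
      and eq: "a \<odot>\<^bsub>Fn S\<^esub> x \<oplus>\<^bsub>Fn S\<^esub> h = a' \<odot>\<^bsub>Fn S\<^esub> x \<oplus>\<^bsub>Fn S\<^esub> h'"
    have "a = a'"
    proof (rule ccontr)
      assume "a \<noteq> a'"
      then have "a \<ominus> a' \<in> Units F" using * field_Units by auto
      then have i: "inv (a \<ominus> a') \<in> carrier F" "inv (a \<ominus> a') \<otimes> (a \<ominus> a') = \<one>" by auto
      have "(a \<ominus> a') \<odot>\<^bsub>Fn S\<^esub> x = a \<odot>\<^bsub>Fn S\<^esub> x \<ominus>\<^bsub>Fn S\<^esub> a' \<odot>\<^bsub>Fn S\<^esub> x"
        using * x by (simp add: a_minus_def V.smult_l_distr V.smult_l_minus)
      also have "\<dots> = ((a \<odot>\<^bsub>Fn S\<^esub> x \<oplus>\<^bsub>Fn S\<^esub> h) \<ominus>\<^bsub>Fn S\<^esub> h) \<ominus>\<^bsub>Fn S\<^esub> a' \<odot>\<^bsub>Fn S\<^esub> x"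
        using * x HC by (simp add: a_minus_def V.a_assoc V.r_neg)
      also have "\<dots> = h' \<ominus>\<^bsub>Fn S\<^esub> h"
        unfolding eq using * x HC
        by (simp add: a_minus_def V.a_ac V.r_neg V.r_neg1 V.r_neg2)
      finally have "(a \<ominus> a') \<odot>\<^bsub>Fn S\<^esub> x \<in> H"
        using submodule_minus[OF H] * by simp
      then have "inv (a \<ominus> a') \<odot>\<^bsub>Fn S\<^esub> ((a \<ominus> a') \<odot>\<^bsub>Fn S\<^esub> x) \<in> H" using D(4) i by blast
      moreover have "inv (a \<ominus> a') \<odot>\<^bsub>Fn S\<^esub> ((a \<ominus> a') \<odot>\<^bsub>Fn S\<^esub> x) = x"
        using i * x(1) by (simp flip: V.smult_assoc1)
      ultimately show False using x(2) by simp
    qed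
    moreover from this have "h = h'" using eq * x HC by simp
    ultimately show "a = a' \<and> h = h'" ..
  qed
  then show ?thesis
    unfolding adjoin_def by (simp add: card_image card_cartesian_product)
qed

primrec list_span :: "'z set \<Rightarrow> ('z \<Rightarrow> 'a) list \<Rightarrow> ('z \<Rightarrow> 'a) set" where
  "list_span S [] = {\<zero>\<^bsub>Fn S\<^esub>}"
| "list_span S (x # xs) = adjoin S x (list_span S xs)"

text \<open>Each entry has to avoid the span of the entries after it. This is linear independence in
  a form where the number of admissible new heads depends only on the length of the tail.\<close>

primrec list_indep :: "'z set \<Rightarrow> ('z \<Rightarrow> 'a) list \<Rightarrow> bool" where
  "list_indep S [] = True"
| "list_indep S (x # xs) = (x \<notin> list_span S xs \<and> list_indep S xs)"

lemma list_span_subset: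
  assumes "submodule F W (Fn S)" "set xs \<subseteq> W"
  shows "list_span S xs \<subseteq> W"
  using assms(2)
  by (induction xs) (use submodule_FnD(2)[OF assms(1)] adjoin_mono[OF assms(1)] in auto)

lemma submodule_list_span:
  assumes "set xs \<subseteq> carrier (Fn S)"
  shows "submodule F (list_span S xs) (Fn S)"
  using assms
proof (induction xs)
  interpret V: vectorspace F "Fn S" by (rule vectorspace_Fn)
  case Nil
  show ?case by (rule submodule_FnI) auto
next
  case (Cons x xs)
  then show ?case by (auto intro: submodule_adjoin)
qed

lemma card_list_span:
  assumes "set xs \<subseteq> carrier (Fn S)" "list_indep S xs"
  shows "card (list_span S xs) = q ^ length xs"
  using assms by (induction xs) (simp_all add: card_adjoin submodule_list_span)

definition indep_lists :: "'z set \<Rightarrow> ('z \<Rightarrow> 'a) set \<Rightarrow> nat \<Rightarrow> ('z \<Rightarrow> 'a) list set" where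
  "indep_lists S W i = {xs. length xs = i \<and> set xs \<subseteq> W \<and> list_indep S xs}"

lemma finite_indep_lists: "finite W \<Longrightarrow> finite (indep_lists S W i)"
  unfolding indep_lists_def by (rule finite_subset[OF _ finite_lists_length_eq[of W i]]) auto

text \<open>A tail of length i spans q^i vectors of \<open>W\<close>, and the new head is any of the
  others. Beyond length n both sides vanish, the right one through the factor j = n, so the
  truncated subtraction is harmless.\<close>

lemma card_indep_lists:
  assumes S: "finite S" and W: "submodule F W (Fn S)" "card W = q ^ n"
  shows "card (indep_lists S W i) = (\<Prod>j<i. q ^ n - q ^ j)"
proof (induction i)
  case 0
  have "indep_lists S W 0 = {[]}" by (auto simp: indep_lists_def)
  then show ?case by simp
next
  case (Suc i)
  note finW = finite_submodule[OF W(1) S]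
  have WC: "W \<subseteq> carrier (Fn S)" using submodule_FnD(1)[OF W(1)] .
  have "indep_lists S W (Suc i) =
      (\<lambda>(xs, x). x # xs) ` (SIGMA xs:indep_lists S W i. W - list_span S xs)"
    by (auto simp: indep_lists_def length_Suc_conv image_iff)
  moreover have "inj_on (\<lambda>(xs, x). x # xs) (SIGMA xs:indep_lists S W i. W - list_span S xs)"
    by (auto simp: inj_on_def)
  ultimately have "card (indep_lists S W (Suc i)) =
      card (SIGMA xs:indep_lists S W i. W - list_span S xs)"
    by (simp add: card_image)
  also have "\<dots> = (\<Sum>xs\<in>indep_lists S W i. card (W - list_span S xs))"
    using finite_indep_lists finW by (intro card_SigmaI) auto
  also have "\<dots> = (\<Sum>xs\<in>indep_lists S W i. q ^ n - q ^ i)"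
  proof (rule sum.cong)
    fix xs assume xs: "xs \<in> indep_lists S W i"
    then have "list_span S xs \<subseteq> W" using list_span_subset[OF W(1)] by (auto simp: indep_lists_def)
    moreover have "card (list_span S xs) = q ^ i"
      using xs WC card_list_span[of xs S] by (auto simp: indep_lists_def)
    ultimately show "card (W - list_span S xs) = q ^ n - q ^ i"
      using finW W(2) by (simp add: card_Diff_subset finite_subset)
  qed simp
  finally show ?case using Suc.IH by simp
qed

text \<open>Double counting: an independent list of length \<open>s\<close> in \<open>W\<close> is the same as one in
  the unique \<open>s\<close>-dimensional subspace it spans.\<close>

lemma card_subspaces:
  assumes S: "finite S" and W: "submodule F W (Fn S)" "card W = q ^ n"
  shows "card {H \<in> subspaces_dim F (Fn S) s. H \<subseteq> W} * (\<Prod>j<s. q ^ s - q ^ j) =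
    (\<Prod>j<s. q ^ n - q ^ j)"
proof -
  define G where "G = {H \<in> subspaces_dim F (Fn S) s. H \<subseteq> W}"
  have G: "H \<in> G \<longleftrightarrow> submodule F H (Fn S) \<and> card H = q ^ s \<and> H \<subseteq> W" for H
    by (auto simp: G_def subspaces_dim_Fn[OF S])
  note finW = finite_submodule[OF W(1) S]
  have finG: "finite G" by (rule finite_subset[of _ "Pow W"]) (use finW in \<open>auto simp: G_def\<close>)
  \<comment> \<open>An independent list of length s in H spans a subset of H with the full number
    q^s of elements, hence H itself. This is what makes the blocks over different H
    disjoint.\<close>
  have span_eq: "list_span S xs = H" if "H \<in> G" "xs \<in> indep_lists S H s" for H xs
  proof (rule card_subset_eq)
    have H: "submodule F H (Fn S)" using that(1) by (simp add: G)
    show "finite H" using finite_submodule[OF H S] .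
    show "list_span S xs \<subseteq> H"
      using list_span_subset[OF H] that(2) by (simp add: indep_lists_def)
    show "card (list_span S xs) = card H"
      using that card_list_span[of xs S] submodule_FnD(1)[OF H] by (auto simp: G indep_lists_def)
  qed
  have "indep_lists S W s = (\<Union>H\<in>G. indep_lists S H s)"
  proof (intro equalityI subsetI)
    fix xs assume xs: "xs \<in> indep_lists S W s"
    then have xsC: "set xs \<subseteq> carrier (Fn S)"
      using submodule_FnD(1)[OF W(1)] by (auto simp: indep_lists_def)
    have "set xs \<subseteq> list_span S xs" using xsC
    proof (induction xs)
      interpret V: vectorspace F "Fn S" by (rule vectorspace_Fn)
      case (Cons x xs)
      note D = submodule_FnD[OF submodule_list_span, of xs S]
      have "\<one> \<odot>\<^bsub>Fn S\<^esub> x \<oplus>\<^bsub>Fn S\<^esub> \<zero>\<^bsub>Fn S\<^esub> = x" using Cons.prems by simp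
      then have "x \<in> adjoin S x (list_span S xs)"
        unfolding adjoin_def using D(2) Cons.prems
        by (intro image_eqI[of _ _ "(\<one>, \<zero>\<^bsub>Fn S\<^esub>)"]) auto
      moreover have "y \<in> adjoin S x (list_span S xs)" if y: "y \<in> list_span S xs" for y
      proof -
        have "\<zero> \<odot>\<^bsub>Fn S\<^esub> x \<oplus>\<^bsub>Fn S\<^esub> y = y" using Cons.prems D(1) y by auto
        then show ?thesis
          unfolding adjoin_def using y by (intro image_eqI[of _ _ "(\<zero>, y)"]) auto
      qed
      ultimately show ?case using Cons by auto
    qed simp
    moreover have "list_span S xs \<in> G"
      using xs xsC card_list_span[OF xsC] submodule_list_span[OF xsC] list_span_subset[OF W(1)]
      by (auto simp: G indep_lists_def)
    ultimately show "xs \<in> (\<Union>H\<in>G. indep_lists S H s)"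
      using xs by (auto simp: indep_lists_def)
  qed (auto simp: G indep_lists_def, blast)
  then have "card (indep_lists S W s) = card (\<Union>H\<in>G. indep_lists S H s)" by simp
  also have "\<dots> = (\<Sum>H\<in>G. card (indep_lists S H s))"
  proof (intro card_UN_disjoint ballI impI)
    show "finite (indep_lists S H s)" if "H \<in> G" for H
      using that finite_subset[OF _ finW, of H] finite_indep_lists[of H] by (auto simp: G)
  qed (use finG span_eq in blast)+
  also have "\<dots> = (\<Sum>H\<in>G. \<Prod>j<s. q ^ s - q ^ j)"
    by (intro sum.cong card_indep_lists S) (auto simp: G)
  finally show ?thesis
    using card_indep_lists[OF S W, of s] by (simp add: G_def)
qed

end

section \<open>Counting linear maps that vanish on a subspace\<close>

context fin_field begin

text \<open>The linear map with prescribed images \<open>y s\<close> of the standard basis vectors.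
  It is restricted to the carrier so that it obeys the extensional convention of
  \<open>lin_maps\<close>.\<close>

definition matrix_map :: "'z set \<Rightarrow> ('a, 'c, 'd) module_scheme \<Rightarrow> ('z \<Rightarrow> 'c) \<Rightarrow> ('z \<Rightarrow> 'a) \<Rightarrow> 'c" where
  "matrix_map S Y y = (\<lambda>w\<in>carrier (Fn S). \<Oplus>\<^bsub>Y\<^esub>s\<in>S. w s \<odot>\<^bsub>Y\<^esub> y s)"

definition unit_vec :: "'z set \<Rightarrow> 'z \<Rightarrow> 'z \<Rightarrow> 'a" where
  "unit_vec S j = (\<lambda>i\<in>S. if i = j then \<one> else \<zero>)"

text \<open>The whole space with its standard basis is an instance of \<open>pivots\<close>, so the
  expansion of a linear map along a dual basis also yields its matrix.\<close>

lemma pivots_unit_vec: "pivots S (carrier (Fn S)) S (unit_vec S)"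
  unfolding pivots_def
proof (intro conjI ballI impI)
  fix h assume "h \<in> carrier (Fn S)" "\<forall>p\<in>S. h p = \<zero>"
  then show "h = \<zero>\<^bsub>Fn S\<^esub>"
    by (intro PiE_ext[of _ S "\<lambda>_. carrier F"]) (auto simp: zero_Fn carrier_Fn)
qed (auto simp: unit_vec_def carrier_Fn)

lemma submodule_carrier_Fn: "submodule F (carrier (Fn S)) (Fn S)"
proof -
  interpret V: vectorspace F "Fn S" by (rule vectorspace_Fn)
  show ?thesis by (rule submodule_FnI) auto
qed

context
  fixes S :: "'z set" and Y :: "('a, 'c, 'd) module_scheme"
  assumes S: "finite S" and Y: "Module.module F Y"
begin

interpretation V: vectorspace F "Fn S" by (rule vectorspace_Fn)
interpretation Y: Module.module F Y by (rule Y)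

lemma coeff_Fn: "w \<in> carrier (Fn S) \<Longrightarrow> s \<in> S \<Longrightarrow> w s \<in> carrier F"
  by (auto simp: carrier_Fn)

lemma matrix_map_in_lin_maps:
  assumes y: "y \<in> S \<rightarrow> carrier Y"
  shows "matrix_map S Y y \<in> lin_maps F (Fn S) Y"
proof -
  have c: "w s \<odot>\<^bsub>Y\<^esub> y s \<in> carrier Y" if "w \<in> carrier (Fn S)" "s \<in> S" for w s
    using y that coeff_Fn by auto
  have cl: "(\<Oplus>\<^bsub>Y\<^esub>s\<in>S. w s \<odot>\<^bsub>Y\<^esub> y s) \<in> carrier Y" if "w \<in> carrier (Fn S)" for w
    using c that by (intro Y.finsum_closed) auto
  have "(\<Oplus>\<^bsub>Y\<^esub>s\<in>S. (v \<oplus>\<^bsub>Fn S\<^esub> w) s \<odot>\<^bsub>Y\<^esub> y s) =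
      (\<Oplus>\<^bsub>Y\<^esub>s\<in>S. v s \<odot>\<^bsub>Y\<^esub> y s) \<oplus>\<^bsub>Y\<^esub> (\<Oplus>\<^bsub>Y\<^esub>s\<in>S. w s \<odot>\<^bsub>Y\<^esub> y s)"
    if vw: "v \<in> carrier (Fn S)" "w \<in> carrier (Fn S)" for v w
  proof -
    have "(\<Oplus>\<^bsub>Y\<^esub>s\<in>S. (v \<oplus>\<^bsub>Fn S\<^esub> w) s \<odot>\<^bsub>Y\<^esub> y s) =
        (\<Oplus>\<^bsub>Y\<^esub>s\<in>S. v s \<odot>\<^bsub>Y\<^esub> y s \<oplus>\<^bsub>Y\<^esub> w s \<odot>\<^bsub>Y\<^esub> y s)"
      using vw y c coeff_Fn
      by (intro Y.finsum_cong') (auto simp: add_Fn Y.smult_l_distr Pi_iff)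
    also have "\<dots> = (\<Oplus>\<^bsub>Y\<^esub>s\<in>S. v s \<odot>\<^bsub>Y\<^esub> y s) \<oplus>\<^bsub>Y\<^esub> (\<Oplus>\<^bsub>Y\<^esub>s\<in>S. w s \<odot>\<^bsub>Y\<^esub> y s)"
      using vw c by (intro Y.finsum_addf) auto
    finally show ?thesis .
  qed
  moreover have "(\<Oplus>\<^bsub>Y\<^esub>s\<in>S. (a \<odot>\<^bsub>Fn S\<^esub> w) s \<odot>\<^bsub>Y\<^esub> y s) = a \<odot>\<^bsub>Y\<^esub> (\<Oplus>\<^bsub>Y\<^esub>s\<in>S. w s \<odot>\<^bsub>Y\<^esub> y s)"
    if aw: "a \<in> carrier F" "w \<in> carrier (Fn S)" for a w
  proof -
    have "(\<Oplus>\<^bsub>Y\<^esub>s\<in>S. (a \<odot>\<^bsub>Fn S\<^esub> w) s \<odot>\<^bsub>Y\<^esub> y s) = (\<Oplus>\<^bsub>Y\<^esub>s\<in>S. a \<odot>\<^bsub>Y\<^esub> (w s \<odot>\<^bsub>Y\<^esub> y s))"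
      using aw y c coeff_Fn
      by (intro Y.finsum_cong') (auto simp: smult_Fn Y.smult_assoc1 Pi_iff)
    also have "\<dots> = a \<odot>\<^bsub>Y\<^esub> (\<Oplus>\<^bsub>Y\<^esub>s\<in>S. w s \<odot>\<^bsub>Y\<^esub> y s)"
      using aw c S by (intro Y.finsum_smult[symmetric]) auto
    finally show ?thesis .
  qed
  ultimately show ?thesis
    using cl by (auto simp: lin_maps_def LinearCombinations.module_hom_def matrix_map_def)
qed

lemma lin_maps_hom: "\<Theta> \<in> lin_maps F (Fn S) Y \<Longrightarrow> mod_hom F (Fn S) Y \<Theta>"
  by (intro mod_hom.intro mod_hom_axioms.intro V.module_axioms Y) (simp add: lin_maps_def)

lemma lin_map_pivots:
  assumes \<Theta>: "\<Theta> \<in> lin_maps F (Fn S) Y" and U: "submodule F U (Fn S)" and Q: "pivots S U Q u"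
    and w: "w \<in> U"
  shows "\<Theta> w = (\<Oplus>\<^bsub>Y\<^esub>p\<in>Q. w p \<odot>\<^bsub>Y\<^esub> \<Theta> (u p))"
proof -
  interpret \<Theta>: mod_hom F "Fn S" Y \<Theta> by (rule lin_maps_hom[OF \<Theta>])
  have c: "u p \<in> carrier (Fn S)" "w p \<in> carrier F" if "p \<in> Q" for p
    using submodule_FnD(1)[OF U] pivot_mem[OF U S Q] pivot_subset[OF U S Q] coeff_Fn that w by blast+
  have hs: "\<Theta> (\<Oplus>\<^bsub>Fn S\<^esub>p\<in>Q'. f p) = (\<Oplus>\<^bsub>Y\<^esub>p\<in>Q'. \<Theta> (f p))"
    if "finite Q'" "f \<in> Q' \<rightarrow> carrier (Fn S)" for Q' :: "'z set" and f
    using that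
  proof (induction Q')
    case (insert p P)
    then have "f p \<in> carrier (Fn S)" "f \<in> P \<rightarrow> carrier (Fn S)" by auto
    with insert show ?case
      by (subst V.finsum_insert, simp_all) (subst Y.finsum_insert, auto)
  qed simp
  have "\<Theta> w = \<Theta> (\<Oplus>\<^bsub>Fn S\<^esub>p\<in>Q. w p \<odot>\<^bsub>Fn S\<^esub> u p)"
    using pivot_expand[OF U S Q w] by (simp add: pivot_comb_def)
  also have "\<dots> = (\<Oplus>\<^bsub>Y\<^esub>p\<in>Q. \<Theta> (w p \<odot>\<^bsub>Fn S\<^esub> u p))"
    using c pivot_finite[OF U S Q] by (intro hs) auto
  also have "\<dots> = (\<Oplus>\<^bsub>Y\<^esub>p\<in>Q. w p \<odot>\<^bsub>Y\<^esub> \<Theta> (u p))"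
    using c by (intro Y.finsum_cong') auto
  finally show ?thesis .
qed

lemma lin_map_eq_matrix_map:
  assumes \<Theta>: "\<Theta> \<in> lin_maps F (Fn S) Y"
  shows "\<Theta> = matrix_map S Y (\<lambda>s\<in>S. \<Theta> (unit_vec S s))"
proof -
  interpret \<Theta>: mod_hom F "Fn S" Y \<Theta> by (rule lin_maps_hom[OF \<Theta>])
  have "unit_vec S s \<in> carrier (Fn S)" for s by (auto simp: unit_vec_def carrier_Fn)
  note u = this
  have "\<Theta> w = (\<Oplus>\<^bsub>Y\<^esub>s\<in>S. w s \<odot>\<^bsub>Y\<^esub> (\<lambda>s\<in>S. \<Theta> (unit_vec S s)) s)" if w: "w \<in> carrier (Fn S)" for w
    unfolding lin_map_pivots[OF \<Theta> submodule_carrier_Fn pivots_unit_vec w]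
    using u w coeff_Fn by (intro Y.finsum_cong') auto
  then show ?thesis
    using \<Theta> by (intro extensionalityI[of _ "carrier (Fn S)"]) (auto simp: lin_maps_def matrix_map_def)
qed

text \<open>By duality \<open>u p\<close> has coordinate 1 at p and 0 at the other pivots, so among
  the pivot values only \<open>y p\<close> survives. The equation that the map kills
  \<open>u p\<close> can thus be solved for \<open>y p\<close>.\<close>

lemma matrix_map_split:
  assumes y: "y \<in> S \<rightarrow> carrier Y" and U: "submodule F U (Fn S)" and Q: "pivots S U Q u"
    and p: "p \<in> Q"
  shows "matrix_map S Y y (u p) = y p \<oplus>\<^bsub>Y\<^esub> (\<Oplus>\<^bsub>Y\<^esub>s\<in>S - Q. u p s \<odot>\<^bsub>Y\<^esub> y s)"
proof -
  have u: "u p \<in> carrier (Fn S)"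
    using submodule_FnD(1)[OF U] pivot_mem[OF U S Q p] by blast
  have QS: "Q \<subseteq> S" and finQ: "finite Q" using pivot_subset[OF U S Q] pivot_finite[OF U S Q] .
  have c: "u p s \<odot>\<^bsub>Y\<^esub> y s \<in> carrier Y" if "s \<in> S" for s
    using that y u coeff_Fn by auto
  have "matrix_map S Y y (u p) = (\<Oplus>\<^bsub>Y\<^esub>s\<in>Q \<union> (S - Q). u p s \<odot>\<^bsub>Y\<^esub> y s)"
    using u QS by (simp add: matrix_map_def Un_absorb1)
  also have "\<dots> = (\<Oplus>\<^bsub>Y\<^esub>s\<in>Q. u p s \<odot>\<^bsub>Y\<^esub> y s) \<oplus>\<^bsub>Y\<^esub> (\<Oplus>\<^bsub>Y\<^esub>s\<in>S - Q. u p s \<odot>\<^bsub>Y\<^esub> y s)"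
    using c QS S finQ by (intro Y.finsum_Un_disjoint) auto
  also have "(\<Oplus>\<^bsub>Y\<^esub>s\<in>Q. u p s \<odot>\<^bsub>Y\<^esub> y s) = (\<Oplus>\<^bsub>Y\<^esub>s\<in>Q. if p = s then y s else \<zero>\<^bsub>Y\<^esub>)"
    using y QS p by (intro Y.finsum_cong') (auto simp: pivot_delta[OF U S Q p] Pi_iff subset_iff)
  also have "\<dots> = y p"
    using y QS p finQ by (intro Y.finsum_singleton) auto
  finally show ?thesis .
qed

text \<open>Vanishing on \<open>U\<close> means vanishing at each \<open>u p\<close>, and that
  equation determines the value at the pivot p from the values at the non-pivots. The latter are
  free, one element of \<open>Y\<close> for each of the \<open>card S - card Q\<close>
  coordinates.\<close>

lemma card_lin_maps_vanishing:
  assumes U: "submodule F U (Fn S)" and Q: "pivots S U Q u"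
  shows "card {\<Theta> \<in> lin_maps F (Fn S) Y. \<forall>w\<in>U. \<Theta> w = \<zero>\<^bsub>Y\<^esub>} = card (carrier Y) ^ (card S - card Q)"
proof -
  have QS: "Q \<subseteq> S" and finQ: "finite Q" using pivot_subset[OF U S Q] pivot_finite[OF U S Q] .
  have u: "u p \<in> carrier (Fn S)" if "p \<in> Q" for p
    using submodule_FnD(1)[OF U] pivot_mem[OF U S Q that] by blast
  define A where "A = {\<Theta> \<in> lin_maps F (Fn S) Y. \<forall>w\<in>U. \<Theta> w = \<zero>\<^bsub>Y\<^esub>}"
  \<comment> \<open>The value at the pivot p that is forced by the values of y off \<open>Q\<close>;
    \<open>ext\<close> completes y by these forced values.\<close>
  define tail where "tail y p = \<ominus>\<^bsub>Y\<^esub> (\<Oplus>\<^bsub>Y\<^esub>s\<in>S - Q. u p s \<odot>\<^bsub>Y\<^esub> y s)" for y p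
  define ext where "ext y = (\<lambda>s\<in>S. if s \<in> Q then tail y s else y s)" for y
  have sumc: "(\<Oplus>\<^bsub>Y\<^esub>s\<in>S - Q. u p s \<odot>\<^bsub>Y\<^esub> y s) \<in> carrier Y"
    if "y \<in> S - Q \<rightarrow> carrier Y" "p \<in> Q" for y p
    using that u coeff_Fn by (intro Y.finsum_closed) auto
  have ext_mem: "ext y \<in> S \<rightarrow>\<^sub>E carrier Y" if "y \<in> S - Q \<rightarrow> carrier Y" for y
    using that sumc[OF that] by (auto simp: ext_def tail_def)
  have ext_tail: "(\<Oplus>\<^bsub>Y\<^esub>s\<in>S - Q. u p s \<odot>\<^bsub>Y\<^esub> ext y s) = (\<Oplus>\<^bsub>Y\<^esub>s\<in>S - Q. u p s \<odot>\<^bsub>Y\<^esub> y s)"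
    if "y \<in> S - Q \<rightarrow> carrier Y" "p \<in> Q" for y p
    using that u coeff_Fn by (intro Y.finsum_cong') (auto simp: ext_def)
  have unit: "matrix_map S Y y (unit_vec S s) = y s" if "y \<in> S \<rightarrow> carrier Y" "s \<in> S" for y s
    using matrix_map_split[OF that(1) submodule_carrier_Fn pivots_unit_vec that(2)] that
    by (simp add: funcset_mem[OF that])
  have "bij_betw (\<lambda>\<Theta>. \<lambda>s\<in>S - Q. \<Theta> (unit_vec S s)) A ((S - Q) \<rightarrow>\<^sub>E carrier Y)"
  proof (rule bij_betwI[where g = "\<lambda>y. matrix_map S Y (ext y)"])
    show "(\<lambda>\<Theta>. \<lambda>s\<in>S - Q. \<Theta> (unit_vec S s)) \<in> A \<rightarrow> (S - Q) \<rightarrow>\<^sub>E carrier Y"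
    proof
      fix \<Theta> assume "\<Theta> \<in> A"
      then interpret \<Theta>: mod_hom F "Fn S" Y \<Theta> by (intro lin_maps_hom) (simp add: A_def)
      have "unit_vec S s \<in> carrier (Fn S)" for s by (auto simp: unit_vec_def carrier_Fn)
      then show "(\<lambda>s\<in>S - Q. \<Theta> (unit_vec S s)) \<in> (S - Q) \<rightarrow>\<^sub>E carrier Y" by auto
    qed
    show "(\<lambda>y. matrix_map S Y (ext y)) \<in> ((S - Q) \<rightarrow>\<^sub>E carrier Y) \<rightarrow> A"
    proof
      fix y assume y: "y \<in> (S - Q) \<rightarrow>\<^sub>E carrier Y"
      then have y': "y \<in> S - Q \<rightarrow> carrier Y" and e: "ext y \<in> S \<rightarrow> carrier Y"
        using ext_mem[of y] by (auto simp: PiE_def)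
      have lm: "matrix_map S Y (ext y) \<in> lin_maps F (Fn S) Y"
        using matrix_map_in_lin_maps[OF e] .
      have "matrix_map S Y (ext y) (u p) = \<zero>\<^bsub>Y\<^esub>" if p: "p \<in> Q" for p
        using sumc[OF y' p] p QS
        by (simp add: matrix_map_split[OF e U Q p] ext_tail[OF y' p])
          (auto simp: ext_def tail_def Y.l_neg)
      then have "matrix_map S Y (ext y) w = \<zero>\<^bsub>Y\<^esub>" if w: "w \<in> U" for w
      proof -
        have "w p \<in> carrier F" if "p \<in> Q" for p
          using submodule_FnD(1)[OF U] w that QS coeff_Fn by blast
        then have "matrix_map S Y (ext y) w = (\<Oplus>\<^bsub>Y\<^esub>p\<in>Q. \<zero>\<^bsub>Y\<^esub>)"
          unfolding lin_map_pivots[OF lm U Q w]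
          using \<open>\<And>p. p \<in> Q \<Longrightarrow> matrix_map S Y (ext y) (u p) = \<zero>\<^bsub>Y\<^esub>\<close>
          by (intro Y.finsum_cong') auto
        then show ?thesis by simp
      qed
      then show "matrix_map S Y (ext y) \<in> A" using lm by (simp add: A_def)
    qed
    show "matrix_map S Y (ext (\<lambda>s\<in>S - Q. \<Theta> (unit_vec S s))) = \<Theta>" if "\<Theta> \<in> A" for \<Theta>
    proof -
      have \<Theta>: "\<Theta> \<in> lin_maps F (Fn S) Y" using that by (simp add: A_def)
      then interpret \<Theta>: mod_hom F "Fn S" Y \<Theta> by (rule lin_maps_hom)
      define y where "y = (\<lambda>s\<in>S. \<Theta> (unit_vec S s))"
      have uc: "unit_vec S s \<in> carrier (Fn S)" for s by (auto simp: unit_vec_def carrier_Fn)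
      have y: "y \<in> S \<rightarrow> carrier Y" using uc by (auto simp: y_def)
      have eq: "\<Theta> = matrix_map S Y y" using lin_map_eq_matrix_map[OF \<Theta>] by (simp add: y_def)
      have yp: "y p = tail y p" if p: "p \<in> Q" for p
      proof -
        have "matrix_map S Y y (u p) = \<zero>\<^bsub>Y\<^esub>"
          using \<open>\<Theta> \<in> A\<close> pivot_mem[OF U S Q p] eq by (simp add: A_def)
        then have "y p \<oplus>\<^bsub>Y\<^esub> (\<Oplus>\<^bsub>Y\<^esub>s\<in>S - Q. u p s \<odot>\<^bsub>Y\<^esub> y s) = \<zero>\<^bsub>Y\<^esub>"
          by (simp add: matrix_map_split[OF y U Q p])
        then have "\<ominus>\<^bsub>Y\<^esub> (\<Oplus>\<^bsub>Y\<^esub>s\<in>S - Q. u p s \<odot>\<^bsub>Y\<^esub> y s) = y p"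
          by (rule Y.minus_equality) (use y p QS sumc[of y p] in auto)
        then show ?thesis by (simp add: tail_def)
      qed
      have tl: "tail (\<lambda>s\<in>S - Q. \<Theta> (unit_vec S s)) p = tail y p" if p: "p \<in> Q" for p
        unfolding tail_def using u[OF p] y coeff_Fn \<Theta>.f_im[OF uc]
        by (intro arg_cong[where f = "a_inv Y"] Y.finsum_cong') (auto simp: y_def)
      have "ext (\<lambda>s\<in>S - Q. \<Theta> (unit_vec S s)) = y"
      proof
        fix s show "ext (\<lambda>s\<in>S - Q. \<Theta> (unit_vec S s)) s = y s"
          by (cases "s \<in> S"; cases "s \<in> Q") (auto simp: ext_def tl simp flip: yp, simp_all add: y_def)
      qed
      then show ?thesis using eq by simp
    qed
    show "(\<lambda>s\<in>S - Q. matrix_map S Y (ext y) (unit_vec S s)) = y"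
      if y: "y \<in> (S - Q) \<rightarrow>\<^sub>E carrier Y" for y
    proof
      fix s show "(\<lambda>s\<in>S - Q. matrix_map S Y (ext y) (unit_vec S s)) s = y s"
        using y ext_mem[of y] by (cases "s \<in> S - Q") (auto simp: unit ext_def PiE_def extensional_def)
    qed
  qed
  then have "card A = card ((S - Q) \<rightarrow>\<^sub>E carrier Y)" by (rule bij_betw_same_card)
  also have "\<dots> = card (carrier Y) ^ (card S - card Q)"
    using S QS finQ by (simp add: card_funcsetE card_Diff_subset)
  finally show ?thesis by (simp add: A_def)
qed

end
end

section \<open>Exterior powers of a subspace\<close>

context fin_field begin

section \<open>Determinants by the Leibniz formula\<close>

lemma perm_sign_closed [simp]: "perm_sign F \<sigma> \<in> carrier F"
  by (simp add: perm_sign_def)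

lemma perm_sign_comp:
  assumes "\<sigma> permutes {..<k::nat}" "\<tau> permutes {..<k}"
  shows "perm_sign F (\<sigma> \<circ> \<tau>) = perm_sign F \<sigma> \<otimes> perm_sign F \<tau>"
proof -
  have "permutation \<sigma>" "permutation \<tau>"
    using assms permutation_permutes by blast+
  then show ?thesis
    by (auto simp: perm_sign_def evenperm_comp l_minus r_minus)
qed

lemma finprod_eq_zero:
  assumes "finite A" "x \<in> A" "f \<in> A \<rightarrow> carrier F" "f x = \<zero>"
  shows "(\<Otimes>j\<in>A. f j) = \<zero>"
proof -
  have "(\<Otimes>j\<in>insert x (A - {x}). f j) = f x \<otimes> (\<Otimes>j\<in>A - {x}. f j)"
    by (rule finprod_insert) (use assms in auto)
  moreover have "(\<Otimes>j\<in>A - {x}. f j) \<in> carrier F"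
    by (rule finprod_closed) (use assms in auto)
  ultimately show ?thesis using assms by (simp add: insert_absorb)
qed

definition leibniz :: "nat \<Rightarrow> (nat \<Rightarrow> nat \<Rightarrow> 'a) \<Rightarrow> 'a" where
  "leibniz k M = (\<Oplus>\<sigma>\<in>{\<sigma>. \<sigma> permutes {..<k}}. perm_sign F \<sigma> \<otimes> (\<Otimes>j\<in>{..<k}. M j (\<sigma> j)))"

lemma permutes_lessThan: "\<sigma> permutes {..<k::nat} \<Longrightarrow> j < k \<Longrightarrow> \<sigma> j < k"
  using permutes_in_image by fastforce

lemma finite_perms: "finite {\<sigma>. \<sigma> permutes {..<k::nat}}"
  by (simp add: finite_permutations)

lemma leibniz_prod_closed:
  fixes k :: nat
  assumes "\<And>j i. j < k \<Longrightarrow> i < k \<Longrightarrow> M j i \<in> carrier F" "\<sigma> permutes {..<k}"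
  shows "(\<Otimes>j\<in>{..<k}. M j (\<sigma> j)) \<in> carrier F"
  by (rule finprod_closed) (use assms(1) permutes_lessThan[OF assms(2)] in auto)

lemma leibniz_closed:
  assumes "\<And>j i. j < k \<Longrightarrow> i < k \<Longrightarrow> M j i \<in> carrier F"
  shows "leibniz k M \<in> carrier F"
  unfolding leibniz_def by (rule finsum_closed) (auto intro!: m_closed leibniz_prod_closed assms)

lemma leibniz_cong:
  assumes "\<And>j i. j < k \<Longrightarrow> i < k \<Longrightarrow> M j i \<in> carrier F"
    and "\<And>j i. j < k \<Longrightarrow> i < k \<Longrightarrow> M' j i = M j i"
  shows "leibniz k M' = leibniz k M"
  unfolding leibniz_def
proof (rule finsum_cong')
  fix \<sigma> assume "\<sigma> \<in> {\<sigma>. \<sigma> permutes {..<k}}"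
  then have \<sigma>: "\<sigma> permutes {..<k}" by simp
  have "(\<Otimes>j\<in>{..<k}. M' j (\<sigma> j)) = (\<Otimes>j\<in>{..<k}. M j (\<sigma> j))"
    by (intro finprod_cong') (auto intro!: assms permutes_lessThan[OF \<sigma>])
  then show "perm_sign F \<sigma> \<otimes> (\<Otimes>j\<in>{..<k}. M' j (\<sigma> j)) = perm_sign F \<sigma> \<otimes> (\<Otimes>j\<in>{..<k}. M j (\<sigma> j))"
    by simp
qed (auto intro!: m_closed leibniz_prod_closed assms)

text \<open>Every Leibniz term contains exactly one entry of row r, namely in column \<sigma> r. The
  cofactor \<open>R\<close> built from the other rows is the same for all three matrices, so
  linearity holds term by term.\<close>

lemma leibniz_row_linear:
  assumes M: "\<And>j i. j < k \<Longrightarrow> i < k \<Longrightarrow> M j i \<in> carrier F" and r: "r < k" and a: "a \<in> carrier F"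
    and x: "\<And>i. i < k \<Longrightarrow> x i \<in> carrier F" and y: "\<And>i. i < k \<Longrightarrow> y i \<in> carrier F"
  shows "leibniz k (M(r := \<lambda>i. a \<otimes> x i \<oplus> y i)) =
    a \<otimes> leibniz k (M(r := x)) \<oplus> leibniz k (M(r := y))"
proof -
  define R where "R \<sigma> = (\<Otimes>j\<in>{..<k} - {r}. M j (\<sigma> j))" for \<sigma>
  have R: "R \<sigma> \<in> carrier F" if "\<sigma> permutes {..<k}" for \<sigma>
    unfolding R_def by (rule finprod_closed) (auto intro!: M permutes_lessThan[OF that])
  have row_split: "(\<Otimes>j\<in>{..<k}. (M(r := z)) j (\<sigma> j)) = z (\<sigma> r) \<otimes> R \<sigma>"
    if \<sigma>: "\<sigma> permutes {..<k}" and z: "\<And>i. i < k \<Longrightarrow> z i \<in> carrier F" for z \<sigma>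
  proof -
    have c: "(\<lambda>j. (M(r := z)) j (\<sigma> j)) \<in> {..<k} - {r} \<rightarrow> carrier F"
      "(M(r := z)) r (\<sigma> r) \<in> carrier F"
      using M z r permutes_lessThan[OF \<sigma>] by auto
    have "(\<Otimes>j\<in>insert r ({..<k} - {r}). (M(r := z)) j (\<sigma> j)) =
        (M(r := z)) r (\<sigma> r) \<otimes> (\<Otimes>j\<in>{..<k} - {r}. (M(r := z)) j (\<sigma> j))"
      by (rule finprod_insert) (use c in auto)
    moreover have "(\<Otimes>j\<in>{..<k} - {r}. (M(r := z)) j (\<sigma> j)) = R \<sigma>"
      unfolding R_def by (rule finprod_cong') (auto intro!: M permutes_lessThan[OF \<sigma>])
    ultimately show ?thesis using r by (simp add: insert_absorb)
  qed
  let ?P = "{\<sigma>. \<sigma> permutes {..<k}}"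
  let ?X = "\<lambda>z \<sigma>. perm_sign F \<sigma> \<otimes> (z (\<sigma> r) \<otimes> R \<sigma>)"
  have Xc: "?X z \<in> ?P \<rightarrow> carrier F" if "\<And>i. i < k \<Longrightarrow> z i \<in> carrier F" for z
  proof
    fix \<sigma> assume "\<sigma> \<in> ?P"
    then have \<sigma>: "\<sigma> permutes {..<k}" by simp
    show "?X z \<sigma> \<in> carrier F"
      using that[OF permutes_lessThan[OF \<sigma> r]] R[OF \<sigma>] by simp
  qed
  have eq: "leibniz k (M(r := z)) = (\<Oplus>\<sigma>\<in>?P. ?X z \<sigma>)"
    if z: "\<And>i. i < k \<Longrightarrow> z i \<in> carrier F" for z
    unfolding leibniz_def
  proof (rule finsum_cong')
    fix \<sigma> assume "\<sigma> \<in> ?P"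
    then have "\<sigma> permutes {..<k}" by simp
    from row_split[OF this, of z, OF z]
    show "perm_sign F \<sigma> \<otimes> (\<Otimes>j\<in>{..<k}. (M(r := z)) j (\<sigma> j)) = ?X z \<sigma>" by simp
  qed (use Xc[of z, OF z] in auto)
  have "leibniz k (M(r := \<lambda>i. a \<otimes> x i \<oplus> y i)) = (\<Oplus>\<sigma>\<in>?P. ?X (\<lambda>i. a \<otimes> x i \<oplus> y i) \<sigma>)"
    by (rule eq[of "\<lambda>i. a \<otimes> x i \<oplus> y i"]) (use a x y in auto)
  also have "\<dots> = (\<Oplus>\<sigma>\<in>?P. a \<otimes> ?X x \<sigma> \<oplus> ?X y \<sigma>)"
  proof (rule finsum_cong')
    fix \<sigma> assume "\<sigma> \<in> ?P"
    then have \<sigma>: "\<sigma> permutes {..<k}" by simp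
    then have "x (\<sigma> r) \<in> carrier F" "y (\<sigma> r) \<in> carrier F" "R \<sigma> \<in> carrier F"
      using R x y permutes_lessThan[OF \<sigma> r] by auto
    then show "?X (\<lambda>i. a \<otimes> x i \<oplus> y i) \<sigma> = a \<otimes> ?X x \<sigma> \<oplus> ?X y \<sigma>"
      using a by (simp add: l_distr r_distr m_ac)
  qed (use a Xc[of x, OF x] Xc[of y, OF y] in auto)
  also have "\<dots> = (\<Oplus>\<sigma>\<in>?P. a \<otimes> ?X x \<sigma>) \<oplus> (\<Oplus>\<sigma>\<in>?P. ?X y \<sigma>)"
    by (rule finsum_addf) (use a Xc[of x, OF x] Xc[of y, OF y] in auto)
  also have "(\<Oplus>\<sigma>\<in>?P. a \<otimes> ?X x \<sigma>) = a \<otimes> (\<Oplus>\<sigma>\<in>?P. ?X x \<sigma>)"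
    by (rule finsum_rdistr[symmetric]) (use a Xc[of x, OF x] finite_perms in auto)
  also have "a \<otimes> (\<Oplus>\<sigma>\<in>?P. ?X x \<sigma>) \<oplus> (\<Oplus>\<sigma>\<in>?P. ?X y \<sigma>) =
      a \<otimes> leibniz k (M(r := x)) \<oplus> leibniz k (M(r := y))"
    by (rule arg_cong2[where f = "\<lambda>u v. a \<otimes> u \<oplus> v"];
      rule eq[of x, OF x, symmetric] eq[of y, OF y, symmetric])
  finally show ?thesis .
qed

lemma leibniz_permute_prod:
  fixes k :: nat
  assumes M: "\<And>j i. j < k \<Longrightarrow> i < k \<Longrightarrow> M j i \<in> carrier F"
    and \<sigma>: "\<sigma> permutes {..<k}" and \<tau>: "\<tau> permutes {..<k}"
  shows "(\<Otimes>j\<in>{..<k}. M (\<tau> j) (\<sigma> (\<tau> j))) = (\<Otimes>j\<in>{..<k}. M j (\<sigma> j))"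
proof -
  have "(\<Otimes>j\<in>\<tau> ` {..<k}. M j (\<sigma> j)) = (\<Otimes>j\<in>{..<k}. M (\<tau> j) (\<sigma> (\<tau> j)))"
    by (rule finprod_reindex)
      (use M permutes_lessThan[OF \<sigma>] permutes_image[OF \<tau>] permutes_inj_on[OF \<tau>] in auto)
  then show ?thesis by (simp add: permutes_image[OF \<tau>])
qed

text \<open>Substitute \<sigma> \<circ> \<tau> for \<sigma>: the product over the rows is only
  reindexed by \<tau>, and the sign splits off the factor of \<tau>.\<close>

lemma leibniz_permute_rows:
  assumes M: "\<And>j i. j < k \<Longrightarrow> i < k \<Longrightarrow> M j i \<in> carrier F" and \<tau>: "\<tau> permutes {..<k}"
  shows "leibniz k (\<lambda>j. M (\<tau> j)) = perm_sign F \<tau> \<otimes> leibniz k M"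
proof -
  let ?P = "{\<sigma>. \<sigma> permutes {..<k}}"
  let ?g = "\<lambda>\<sigma>. perm_sign F \<sigma> \<otimes> (\<Otimes>j\<in>{..<k}. M (\<tau> j) (\<sigma> j))"
  have im: "(\<lambda>\<sigma>. \<sigma> \<circ> \<tau>) ` ?P = ?P"
  proof -
    have "(\<lambda>\<sigma>. \<sigma> \<circ> \<tau>) ` ?P = {\<sigma> \<circ> \<tau> |\<sigma>. \<sigma> permutes {..<k}}" by blast
    then show ?thesis by (simp add: image_compose_permutations_right[OF \<tau>])
  qed
  have inj: "inj_on (\<lambda>\<sigma>. \<sigma> \<circ> \<tau>) ?P"
  proof (rule inj_onI)
    fix \<sigma> \<sigma>' assume "\<sigma> \<circ> \<tau> = \<sigma>' \<circ> \<tau>"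
    then have "\<sigma> \<circ> \<tau> \<circ> Hilbert_Choice.inv \<tau> = \<sigma>' \<circ> \<tau> \<circ> Hilbert_Choice.inv \<tau>" by simp
    then show "\<sigma> = \<sigma>'" by (simp add: comp_assoc permutes_inv_o[OF \<tau>])
  qed
  have gc: "?g \<in> ?P \<rightarrow> carrier F"
    using M permutes_lessThan[OF \<tau>] by (auto intro!: leibniz_prod_closed[of k "\<lambda>j. M (\<tau> j)"])
  have "leibniz k (\<lambda>j. M (\<tau> j)) = (\<Oplus>\<sigma>\<in>(\<lambda>\<sigma>. \<sigma> \<circ> \<tau>) ` ?P. ?g \<sigma>)"
    by (simp add: leibniz_def im)
  also have "\<dots> = (\<Oplus>\<sigma>\<in>?P. ?g (\<sigma> \<circ> \<tau>))"
    by (rule finsum_reindex) (use gc im inj in auto)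
  also have "\<dots> = (\<Oplus>\<sigma>\<in>?P. perm_sign F \<tau> \<otimes> (perm_sign F \<sigma> \<otimes> (\<Otimes>j\<in>{..<k}. M j (\<sigma> j))))"
  proof (rule finsum_cong')
    fix \<sigma> assume "\<sigma> \<in> ?P"
    then have \<sigma>: "\<sigma> permutes {..<k}" by simp
    show "?g (\<sigma> \<circ> \<tau>) = perm_sign F \<tau> \<otimes> (perm_sign F \<sigma> \<otimes> (\<Otimes>j\<in>{..<k}. M j (\<sigma> j)))"
      using leibniz_permute_prod[of k M, OF M \<sigma> \<tau>] leibniz_prod_closed[of k M, OF M \<sigma>]
      by (simp add: perm_sign_comp[OF \<sigma> \<tau>] m_ac)
  qed (auto intro!: m_closed leibniz_prod_closed M)
  also have "\<dots> = perm_sign F \<tau> \<otimes> leibniz k M"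
    unfolding leibniz_def
    by (rule finsum_rdistr[symmetric]) (auto intro!: m_closed leibniz_prod_closed M finite_perms)
  finally show ?thesis .
qed

text \<open>In characteristic 2 antisymmetry does not suffice, so the even and the odd permutations
  are cancelled against each other.\<close>

lemma leibniz_eq_rows:
  assumes M: "\<And>j i. j < k \<Longrightarrow> i < k \<Longrightarrow> M j i \<in> carrier F"
    and rc: "r < k" "c < k" "r \<noteq> c" "\<And>i. i < k \<Longrightarrow> M r i = M c i"
  shows "leibniz k M = \<zero>"
proof -
  define t where "t = Transposition.transpose r c"
  have t: "t permutes {..<k}" unfolding t_def using rc by (intro permutes_swap_id) auto
  have tt: "t \<circ> t = id" by (simp add: t_def)
  have odd: "\<not> evenperm t" using rc by (simp add: t_def evenperm_swap)
  let ?g = "\<lambda>\<sigma>. perm_sign F \<sigma> \<otimes> (\<Otimes>j\<in>{..<k}. M j (\<sigma> j))"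
  let ?E = "{\<sigma>. \<sigma> permutes {..<k} \<and> evenperm \<sigma>}"
  let ?O = "{\<sigma>. \<sigma> permutes {..<k} \<and> \<not> evenperm \<sigma>}"
  have ev: "evenperm (\<sigma> \<circ> t) \<longleftrightarrow> \<not> evenperm \<sigma>" if "\<sigma> permutes {..<k}" for \<sigma>
  proof -
    have "permutation \<sigma>" "permutation t" using that t permutation_permutes by blast+
    then show ?thesis using odd by (simp add: evenperm_comp)
  qed
  have gc: "?g \<sigma> \<in> carrier F" if "\<sigma> permutes {..<k}" for \<sigma>
    using leibniz_prod_closed[of k M \<sigma>] M that by auto
  have O: "?O = (\<lambda>\<sigma>. \<sigma> \<circ> t) ` ?E"
  proof (intro equalityI subsetI)
    fix \<sigma> assume \<sigma>: "\<sigma> \<in> ?O"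
    then have "\<sigma> \<circ> t \<in> ?E" using ev permutes_compose[OF t] by simp
    moreover have "\<sigma> = (\<sigma> \<circ> t) \<circ> t" by (simp add: comp_assoc tt)
    ultimately show "\<sigma> \<in> (\<lambda>\<sigma>. \<sigma> \<circ> t) ` ?E" by blast
  next
    fix \<sigma>' assume "\<sigma>' \<in> (\<lambda>\<sigma>. \<sigma> \<circ> t) ` ?E"
    then obtain \<sigma> where "\<sigma>' = \<sigma> \<circ> t" "\<sigma> permutes {..<k}" "evenperm \<sigma>" by blast
    then show "\<sigma>' \<in> ?O" using ev permutes_compose[OF t] by simp
  qed
  have inj: "inj_on (\<lambda>\<sigma>. \<sigma> \<circ> t) ?E"
  proof (rule inj_onI)
    fix \<sigma> \<sigma>' assume "\<sigma> \<circ> t = \<sigma>' \<circ> t"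
    then have "\<sigma> \<circ> t \<circ> t = \<sigma>' \<circ> t \<circ> t" by simp
    then show "\<sigma> = \<sigma>'" by (simp add: comp_assoc tt)
  qed
  have neg: "?g (\<sigma> \<circ> t) = \<ominus> ?g \<sigma>" if \<sigma>: "\<sigma> permutes {..<k}" for \<sigma>
  proof -
    \<comment> \<open>Rows r and c agree, so t may be inserted in the row index at no cost. With t
      in both indices it disappears by reindexing the product.\<close>
    have "(\<Otimes>j\<in>{..<k}. M j ((\<sigma> \<circ> t) j)) = (\<Otimes>j\<in>{..<k}. M (t j) (\<sigma> (t j)))"
    proof (rule finprod_cong')
      fix j assume "j \<in> {..<k}"
      then have j: "j < k" "\<sigma> (t j) < k"
        using permutes_lessThan[OF \<sigma>] permutes_lessThan[OF t] by auto
      then show "M j ((\<sigma> \<circ> t) j) = M (t j) (\<sigma> (t j))"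
        using rc(4) by (cases "j = r \<or> j = c") (auto simp: t_def)
    qed (auto intro!: M permutes_lessThan[OF \<sigma>] permutes_lessThan[OF t])
    also have "\<dots> = (\<Otimes>j\<in>{..<k}. M j (\<sigma> j))"
      by (rule leibniz_permute_prod[of k M, OF M \<sigma> t])
    finally show ?thesis
      using leibniz_prod_closed[of k M, OF M \<sigma>] odd
      by (simp add: perm_sign_comp[OF \<sigma> t]) (simp add: perm_sign_def l_minus)
  qed
  have fin: "finite ?E" "finite ?O"
    using finite_perms[of k] by (auto intro: rev_finite_subset)
  have "(\<Oplus>\<sigma>\<in>?O. ?g \<sigma>) = (\<Oplus>\<sigma>\<in>?E. ?g (\<sigma> \<circ> t))"
    unfolding O
  proof (rule finsum_reindex)
    show "?g \<in> (\<lambda>\<sigma>. \<sigma> \<circ> t) ` ?E \<rightarrow> carrier F"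
      unfolding O[symmetric] using gc by blast
  qed (rule inj)
  also have "\<dots> = (\<Oplus>\<sigma>\<in>?E. \<ominus> \<one> \<otimes> ?g \<sigma>)"
  proof (rule finsum_cong')
    fix \<sigma> assume "\<sigma> \<in> ?E"
    then have \<sigma>: "\<sigma> permutes {..<k}" by simp
    have "\<ominus> ?g \<sigma> = \<ominus> \<one> \<otimes> ?g \<sigma>"
      using l_minus[of \<one> "?g \<sigma>"] gc[OF \<sigma>] by simp
    then show "?g (\<sigma> \<circ> t) = \<ominus> \<one> \<otimes> ?g \<sigma>"
      using neg[OF \<sigma>] by (rule trans[rotated])
  qed (auto intro!: m_closed leibniz_prod_closed M)
  also have "\<dots> = \<ominus> \<one> \<otimes> (\<Oplus>\<sigma>\<in>?E. ?g \<sigma>)"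
    by (rule finsum_rdistr[symmetric]) (use gc fin in \<open>blast | simp\<close>)+
  finally have odd_sum: "(\<Oplus>\<sigma>\<in>?O. ?g \<sigma>) = \<ominus> \<one> \<otimes> (\<Oplus>\<sigma>\<in>?E. ?g \<sigma>)" .
  have U: "{\<sigma>. \<sigma> permutes {..<k}} = ?E \<union> ?O" by blast
  have "leibniz k M = (\<Oplus>\<sigma>\<in>?E \<union> ?O. ?g \<sigma>)" unfolding leibniz_def U ..
  also have "\<dots> = (\<Oplus>\<sigma>\<in>?E. ?g \<sigma>) \<oplus> (\<Oplus>\<sigma>\<in>?O. ?g \<sigma>)"
  proof (rule finsum_Un_disjoint)
    show "?g \<in> ?E \<rightarrow> carrier F" "?g \<in> ?O \<rightarrow> carrier F" using gc by blast+
    show "?E \<inter> ?O = {}" by blast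
  qed (rule fin)+
  also have "\<dots> = \<zero>"
  proof -
    have "(\<Oplus>\<sigma>\<in>?E. ?g \<sigma>) \<in> carrier F" by (rule finsum_closed) (use gc in blast)
    then show ?thesis unfolding odd_sum by (simp add: l_minus r_neg)
  qed
  finally show ?thesis .
qed

section \<open>Wedge products as vectors of minors\<close>

lemma wedge_apply:
  "I \<in> k_subsets N k \<Longrightarrow> wedge F k N v I = leibniz k (\<lambda>j i. v j (sorted_list_of_set I ! i))"
  by (simp add: wedge_def leibniz_def)

lemma finite_k_subsets: "finite (k_subsets N k)"
  by (simp add: k_subsets_def)

lemma k_subset_nth:
  assumes "I \<in> k_subsets N k" "i < k"
  shows "sorted_list_of_set I ! i \<in> I" "sorted_list_of_set I ! i < N"
proof -
  have "finite I" "card I = k" "I \<subseteq> {..<N}"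
    using assms(1) finite_subset by (auto simp: k_subsets_def)
  then show "sorted_list_of_set I ! i \<in> I"
    using assms(2) nth_mem[of i "sorted_list_of_set I"] by simp
  then show "sorted_list_of_set I ! i < N" using \<open>I \<subseteq> {..<N}\<close> by auto
qed

lemma k_subset_bij_betw:
  assumes "I \<in> k_subsets N k"
  shows "bij_betw ((!) (sorted_list_of_set I)) {..<k} I"
proof -
  have "finite I" "card I = k"
    using assms finite_subset by (auto simp: k_subsets_def)
  show ?thesis
    by (rule bij_betw_nth) (simp_all add: \<open>finite I\<close> \<open>card I = k\<close>)
qed

lemma wedge_entry:
  assumes "I \<in> k_subsets N k" "i < k" "v j \<in> carrier (Fn {..<N})"
  shows "v j (sorted_list_of_set I ! i) \<in> carrier F"
  using k_subset_nth(2)[OF assms(1,2)] assms(3) by (auto simp: carrier_Fn PiE_iff)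

lemma wedge_closed:
  assumes "\<And>j. j < k \<Longrightarrow> v j \<in> carrier (Fn {..<N})"
  shows "wedge F k N v \<in> carrier (Fn (k_subsets N k))"
proof -
  have "wedge F k N v I \<in> carrier F" if "I \<in> k_subsets N k" for I
    unfolding wedge_apply[OF that]
  proof (rule leibniz_closed)
    show "v j (sorted_list_of_set I ! i) \<in> carrier F" if "j < k" "i < k" for i j
      by (rule wedge_entry[OF \<open>I \<in> k_subsets N k\<close> that(2), of v j, OF assms[OF that(1)]])
  qed
  then show ?thesis by (auto simp: carrier_Fn wedge_def)
qed

lemma wedge_eqI:
  assumes "w \<in> carrier (Fn (k_subsets N k))"
    and "\<And>I. I \<in> k_subsets N k \<Longrightarrow> wedge F k N v I = w I"
  shows "wedge F k N v = w"
proof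
  fix I show "wedge F k N v I = w I"
    using assms by (cases "I \<in> k_subsets N k") (auto simp: carrier_Fn wedge_def)
qed

lemma wedge_slot_linear:
  assumes v: "\<And>j. j < k \<Longrightarrow> v j \<in> carrier (Fn {..<N})" and r: "r < k" and a: "a \<in> carrier F"
    and xy: "x \<in> carrier (Fn {..<N})" "y \<in> carrier (Fn {..<N})"
  shows "wedge F k N (v(r := a \<odot>\<^bsub>Fn {..<N}\<^esub> x \<oplus>\<^bsub>Fn {..<N}\<^esub> y)) =
    a \<odot>\<^bsub>Fn (k_subsets N k)\<^esub> wedge F k N (v(r := x)) \<oplus>\<^bsub>Fn (k_subsets N k)\<^esub> wedge F k N (v(r := y))"
proof -
  interpret V: vectorspace F "Fn {..<N}" by (rule vectorspace_Fn)
  interpret W: vectorspace F "Fn (k_subsets N k)" by (rule vectorspace_Fn)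
  have wc: "wedge F k N (v(r := z)) \<in> carrier (Fn (k_subsets N k))"
    if "z \<in> carrier (Fn {..<N})" for z
    by (rule wedge_closed) (use v that in auto)
  show ?thesis
  proof (rule wedge_eqI)
    fix I assume I: "I \<in> k_subsets N k"
    let ?s = "\<lambda>i. sorted_list_of_set I ! i"
    have c: "v j (?s i) \<in> carrier F" if "j < k" "i < k" for i j
      by (rule wedge_entry[OF I that(2), of v j, OF v[OF that(1)]])
    have cx: "i < k \<Longrightarrow> x (?s i) \<in> carrier F" "i < k \<Longrightarrow> y (?s i) \<in> carrier F" for i
      using wedge_entry[OF I, of i "\<lambda>_. x"] wedge_entry[OF I, of i "\<lambda>_. y"] xy by auto
    have upd: "wedge F k N (v(r := z)) I = leibniz k ((\<lambda>j i. v j (?s i))(r := \<lambda>i. z (?s i)))" for z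
    proof -
      have "(\<lambda>j i. (v(r := z)) j (?s i)) = (\<lambda>j i. v j (?s i))(r := \<lambda>i. z (?s i))" by auto
      then show ?thesis by (simp only: wedge_apply[OF I])
    qed
    have "wedge F k N (v(r := a \<odot>\<^bsub>Fn {..<N}\<^esub> x \<oplus>\<^bsub>Fn {..<N}\<^esub> y)) I =
        leibniz k ((\<lambda>j i. v j (?s i))(r := \<lambda>i. a \<otimes> x (?s i) \<oplus> y (?s i)))"
      unfolding upd
      by (rule leibniz_cong)
        (use c cx a k_subset_nth(2)[OF I] in \<open>auto simp: add_Fn smult_Fn\<close>)
    also have "\<dots> = a \<otimes> leibniz k ((\<lambda>j i. v j (?s i))(r := \<lambda>i. x (?s i))) \<oplus>
        leibniz k ((\<lambda>j i. v j (?s i))(r := \<lambda>i. y (?s i)))"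
      by (rule leibniz_row_linear) (use c cx a r in auto)
    finally show "wedge F k N (v(r := a \<odot>\<^bsub>Fn {..<N}\<^esub> x \<oplus>\<^bsub>Fn {..<N}\<^esub> y)) I =
        (a \<odot>\<^bsub>Fn (k_subsets N k)\<^esub> wedge F k N (v(r := x)) \<oplus>\<^bsub>Fn (k_subsets N k)\<^esub>
          wedge F k N (v(r := y))) I"
      using I by (simp add: upd add_Fn smult_Fn)
  qed (use wc xy a in auto)
qed

text \<open>Linearity in one slot, in the form needed for spanning: to place a wedge in
  \<open>E\<close> for every vector of \<open>H\<close> in slot r, it suffices to test a basis of
  \<open>H\<close> there.\<close>

lemma wedge_slot_submodule:
  assumes H: "submodule F H (Fn {..<N})" and E: "submodule F E (Fn (k_subsets N k))"
    and v: "\<And>j. j < k \<Longrightarrow> v j \<in> H" and r: "r < k"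
  shows "submodule F {x \<in> H. wedge F k N (v(r := x)) \<in> E} (Fn {..<N})"
proof -
  interpret V: vectorspace F "Fn {..<N}" by (rule vectorspace_Fn)
  interpret W: vectorspace F "Fn (k_subsets N k)" by (rule vectorspace_Fn)
  note D = submodule_FnD[OF H] and DE = submodule_FnD[OF E]
  have HC: "x \<in> carrier (Fn {..<N})" if "x \<in> H" for x using that D(1) by blast
  have vC: "v j \<in> carrier (Fn {..<N})" if "j < k" for j using HC v that by blast
  note lin = wedge_slot_linear[of k v N r, OF vC r]
  let ?w = "\<lambda>x. wedge F k N (v(r := x))"
  have wc: "?w x \<in> carrier (Fn (k_subsets N k))" if "x \<in> H" for x
    by (rule wedge_closed) (use vC HC that in auto)
  \<comment> \<open>Slot linearity with a = -1 and x = y = 0 writes this wedge as the sum of its own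
    negative and itself.\<close>
  have w0: "?w \<zero>\<^bsub>Fn {..<N}\<^esub> = \<zero>\<^bsub>Fn (k_subsets N k)\<^esub>"
    using lin[of "\<ominus> \<one>" "\<zero>\<^bsub>Fn {..<N}\<^esub>" "\<zero>\<^bsub>Fn {..<N}\<^esub>"] wc[OF D(2)]
    by (simp add: W.smult_l_minus W.l_neg)
  show ?thesis
  proof (rule submodule_FnI)
    show "{x \<in> H. ?w x \<in> E} \<subseteq> carrier (Fn {..<N})" using D(1) by blast
    show "\<zero>\<^bsub>Fn {..<N}\<^esub> \<in> {x \<in> H. ?w x \<in> E}" using w0 D(2) DE(2) by simp
  next
    fix x y assume xy: "x \<in> {x \<in> H. ?w x \<in> E}" "y \<in> {x \<in> H. ?w x \<in> E}"
    then have "?w (x \<oplus>\<^bsub>Fn {..<N}\<^esub> y) = ?w x \<oplus>\<^bsub>Fn (k_subsets N k)\<^esub> ?w y"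
      using lin[of \<one> x y] HC wc by simp
    then show "x \<oplus>\<^bsub>Fn {..<N}\<^esub> y \<in> {x \<in> H. ?w x \<in> E}"
      using xy D(3) DE(3) by simp
  next
    fix a x assume ax: "a \<in> carrier F" "x \<in> {x \<in> H. ?w x \<in> E}"
    then have "?w (a \<odot>\<^bsub>Fn {..<N}\<^esub> x) = a \<odot>\<^bsub>Fn (k_subsets N k)\<^esub> ?w x"
      using lin[of a x "\<zero>\<^bsub>Fn {..<N}\<^esub>"] HC wc w0 by simp
    then show "a \<odot>\<^bsub>Fn {..<N}\<^esub> x \<in> {x \<in> H. ?w x \<in> E}"
      using ax D(4) DE(4) by simp
  qed
qed

section \<open>A dual basis of the exterior power of a subspace\<close>

context
  fixes N k :: nat and H P b
  assumes H: "submodule F H (Fn {..<N})" and P: "pivots {..<N} H P b"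
begin

definition basis_wedge :: "nat set \<Rightarrow> nat set \<Rightarrow> 'a" where
  "basis_wedge J = wedge F k N (\<lambda>j. b (sorted_list_of_set J ! j))"

definition pivot_subsets :: "nat set set" where
  "pivot_subsets = {J. J \<subseteq> P \<and> card J = k}"

lemma pivot_subsets_subset: "pivot_subsets \<subseteq> k_subsets N k"
  using pivot_subset[OF H _ P] by (auto simp: pivot_subsets_def k_subsets_def)

lemma finite_pivot_subsets: "finite pivot_subsets"
  using pivot_subsets_subset finite_k_subsets by (rule finite_subset)

lemma card_pivot_subsets: "card pivot_subsets = card P choose k"
  unfolding pivot_subsets_def using pivot_finite[OF H _ P] by (intro n_subsets) simp

lemma basis_vec_mem:
  assumes "J \<in> pivot_subsets" "j < k"
  shows "sorted_list_of_set J ! j \<in> P" "b (sorted_list_of_set J ! j) \<in> H"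
    "b (sorted_list_of_set J ! j) \<in> carrier (Fn {..<N})"
proof -
  show "sorted_list_of_set J ! j \<in> P"
    using k_subset_nth(1)[of J N k j] assms pivot_subsets_subset by (auto simp: pivot_subsets_def)
  then show "b (sorted_list_of_set J ! j) \<in> H"
    using pivot_mem[OF H _ P] by simp
  then show "b (sorted_list_of_set J ! j) \<in> carrier (Fn {..<N})"
    using submodule_FnD(1)[OF H] by blast
qed

lemma basis_wedge_closed: "J \<in> pivot_subsets \<Longrightarrow> basis_wedge J \<in> carrier (Fn (k_subsets N k))"
  unfolding basis_wedge_def by (rule wedge_closed) (rule basis_vec_mem)

text \<open>The minor has entry 1 where the i-th element of I equals the j-th element of J, and 0
  elsewhere. A nonzero Leibniz term needs a match in every row; comparing images then gives I = J,
  and injectivity of the enumeration gives \<sigma> = \<open>id\<close>.\<close>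

lemma basis_wedge_delta:
  assumes I: "I \<in> pivot_subsets" and J: "J \<in> pivot_subsets"
  shows "basis_wedge J I = (if I = J then \<one> else \<zero>)"
proof -
  have I': "I \<in> k_subsets N k" and J': "J \<in> k_subsets N k"
    using I J pivot_subsets_subset by auto
  let ?M = "\<lambda>j i. b (sorted_list_of_set J ! j) (sorted_list_of_set I ! i)"
  let ?P = "{\<sigma>. \<sigma> permutes {..<k}}"
  have M: "?M j i = (if sorted_list_of_set I ! i = sorted_list_of_set J ! j then \<one> else \<zero>)"
    if "j < k" "i < k" for i j
    using pivot_delta[OF H _ P] basis_vec_mem(1) I J that by simp
  have Mc: "?M j i \<in> carrier F" if "j < k" "i < k" for i j
    by (simp add: M[OF that])
  have z: "(\<Otimes>j\<in>{..<k}. ?M j (\<sigma> j)) = \<zero>" if \<sigma>: "\<sigma> permutes {..<k}" and ne: "\<not> (I = J \<and> \<sigma> = id)" for \<sigma>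
  proof -
    have "\<exists>j<k. sorted_list_of_set I ! \<sigma> j \<noteq> sorted_list_of_set J ! j"
    proof (rule ccontr)
      assume "\<not> ?thesis"
      then have eq: "sorted_list_of_set I ! \<sigma> j = sorted_list_of_set J ! j" if "j < k" for j
        using that by blast
      have "J = ((!) (sorted_list_of_set J)) ` {..<k}"
        using k_subset_bij_betw[OF J'] by (simp add: bij_betw_def)
      also have "\<dots> = ((!) (sorted_list_of_set I)) ` \<sigma> ` {..<k}"
        using eq by (simp add: image_image)
      also have "\<dots> = I"
        using k_subset_bij_betw[OF I'] by (simp add: bij_betw_def permutes_image[OF \<sigma>])
      finally have IJ: "I = J" by simp
      have "\<sigma> j = j" for j
      proof (cases "j < k")
        case True
        then have "sorted_list_of_set J ! \<sigma> j = sorted_list_of_set J ! j"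
          using eq IJ by simp
        then show ?thesis
          using k_subset_bij_betw[OF J'] True permutes_lessThan[OF \<sigma> True]
          by (auto simp: bij_betw_def inj_on_def)
      next
        case False
        then show ?thesis using \<sigma> by (simp add: permutes_def)
      qed
      then show False using ne IJ by (simp add: fun_eq_iff)
    qed
    then obtain j where j: "j < k" "sorted_list_of_set I ! \<sigma> j \<noteq> sorted_list_of_set J ! j" by blast
    have "?M j (\<sigma> j) = \<zero>" using M[OF j(1) permutes_lessThan[OF \<sigma> j(1)]] j(2) by simp
    then show ?thesis
      using j(1) by (intro finprod_eq_zero[of _ j]) (auto intro!: Mc permutes_lessThan[OF \<sigma>])
  qed
  have eq: "basis_wedge J I = (\<Oplus>\<sigma>\<in>?P. perm_sign F \<sigma> \<otimes> (\<Otimes>j\<in>{..<k}. ?M j (\<sigma> j)))"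
    by (simp add: basis_wedge_def wedge_apply[OF I'] leibniz_def)
  show ?thesis
  proof (cases "I = J")
    case True
    have one: "(\<Otimes>j\<in>{..<k}. ?M j (id j)) = \<one>"
    proof -
      have "(\<Otimes>j\<in>{..<k}. ?M j (id j)) = (\<Otimes>j\<in>{..<k}. \<one>)"
        by (rule finprod_cong') (use M True in auto)
      then show ?thesis by simp
    qed
    have "basis_wedge J I = \<one>"
      unfolding eq
    proof (rule finsum_delta[where j = id])
      fix \<sigma> assume "\<sigma> \<in> ?P"
      then show "perm_sign F \<sigma> \<otimes> (\<Otimes>j\<in>{..<k}. ?M j (\<sigma> j)) = (if \<sigma> = id then \<one> else \<zero>)"
        using one z[of \<sigma>] by (auto simp: perm_sign_def)
    qed (auto simp: finite_perms permutes_id)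
    then show ?thesis using True by simp
  next
    case False
    have "basis_wedge J I = (\<Oplus>\<sigma>\<in>?P. \<zero>)"
      unfolding eq by (rule finsum_cong') (use z False in auto)
    then show ?thesis using False by simp
  qed
qed

lemma ext_power_sub_eq: "ext_power_sub F k N H =
    LinearCombinations.module.span F (Fn (k_subsets N k)) {wedge F k N v |v. \<forall>j<k. v j \<in> H}"
  by (simp add: ext_power_sub_def)

lemma wedges_carrier: "{wedge F k N v |v. \<forall>j<k. v j \<in> H} \<subseteq> carrier (Fn (k_subsets N k))"
  using submodule_FnD(1)[OF H] by (auto intro!: wedge_closed)

lemma submodule_ext_power_sub: "submodule F (ext_power_sub F k N H) (Fn (k_subsets N k))"
proof -
  interpret W: vectorspace F "Fn (k_subsets N k)" by (rule vectorspace_Fn)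
  show ?thesis
    unfolding ext_power_sub_eq by (rule W.span_is_submodule[OF wedges_carrier])
qed

lemma wedge_in_ext_power_sub: "(\<And>j. j < k \<Longrightarrow> v j \<in> H) \<Longrightarrow> wedge F k N v \<in> ext_power_sub F k N H"
proof -
  interpret W: vectorspace F "Fn (k_subsets N k)" by (rule vectorspace_Fn)
  assume "\<And>j. j < k \<Longrightarrow> v j \<in> H"
  then show ?thesis
    unfolding ext_power_sub_eq using W.in_own_span[OF wedges_carrier] by blast
qed

text \<open>A repeated pivot makes two rows of every minor equal, so the wedge is zero. Without
  repetition, sorting the factors produces some \<open>basis_wedge J\<close> up to sign.\<close>

lemma wedge_basis_vecs:
  assumes E: "submodule F E (Fn (k_subsets N k))" "basis_wedge ` pivot_subsets \<subseteq> E"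
    and f: "\<And>j. j < k \<Longrightarrow> f j \<in> P" and v: "\<And>j. j < k \<Longrightarrow> v j = b (f j)"
  shows "wedge F k N v \<in> E"
proof -
  interpret W: vectorspace F "Fn (k_subsets N k)" by (rule vectorspace_Fn)
  note DE = submodule_FnD[OF E(1)]
  have vC: "v j \<in> carrier (Fn {..<N})" if "j < k" for j
    using submodule_FnD(1)[OF H] pivot_mem[OF H _ P f[OF that]] v[OF that] by auto
  show ?thesis
  proof (cases "inj_on f {..<k}")
    case False
    then obtain r c where rc: "r < k" "c < k" "r \<noteq> c" "f r = f c" by (auto simp: inj_on_def)
    have "wedge F k N v = \<zero>\<^bsub>Fn (k_subsets N k)\<^esub>"
    proof (rule wedge_eqI)
      fix I assume I: "I \<in> k_subsets N k"
      have "wedge F k N v I = \<zero>"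
        unfolding wedge_apply[OF I]
      proof (rule leibniz_eq_rows[OF _ rc(1,2,3)])
        show "v j (sorted_list_of_set I ! i) \<in> carrier F" if "j < k" "i < k" for i j
          using wedge_entry[OF I that(2), of v j] vC[OF that(1)] .
      qed (simp add: v rc)
      then show "wedge F k N v I = \<zero>\<^bsub>Fn (k_subsets N k)\<^esub> I" using I by (simp add: zero_Fn)
    qed simp
    then show ?thesis using DE(2) by simp
  next
    case True
    define J where "J = f ` {..<k}"
    have J: "J \<in> pivot_subsets"
      using f True by (auto simp: J_def pivot_subsets_def card_image)
    then have J': "J \<in> k_subsets N k" using pivot_subsets_subset by blast
    let ?s = "\<lambda>j. sorted_list_of_set J ! j"
    note bij = k_subset_bij_betw[OF J']
    \<comment> \<open>The sorting permutation: the position of \<open>f j\<close> in the increasing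
      enumeration of \<open>J\<close>. It is the identity from k on, as \<open>permutes\<close>
      demands.\<close>
    define \<tau> where "\<tau> j = (if j < k then inv_into {..<k} ?s (f j) else j)" for j
    have s\<tau>: "?s (\<tau> j) = f j" if "j < k" for j
      using bij that by (auto simp: \<tau>_def J_def bij_betw_def intro!: f_inv_into_f)
    have "bij_betw (inv_into {..<k} ?s \<circ> f) {..<k} {..<k}"
      using True bij_betw_inv_into[OF bij]
      by (intro bij_betw_trans[of f _ J]) (auto simp: bij_betw_def J_def)
    then have "bij_betw \<tau> {..<k} {..<k}"
      by (rule bij_betw_cong[THEN iffD1, rotated]) (simp add: \<tau>_def)
    then have \<tau>: "\<tau> permutes {..<k}"
      by (rule bij_imp_permutes) (simp add: \<tau>_def)
    have "wedge F k N v = perm_sign F \<tau> \<odot>\<^bsub>Fn (k_subsets N k)\<^esub> basis_wedge J"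
    proof (rule wedge_eqI)
      fix I assume I: "I \<in> k_subsets N k"
      let ?M = "\<lambda>j i. b (?s j) (sorted_list_of_set I ! i)"
      have Mc: "?M j i \<in> carrier F" if "j < k" "i < k" for i j
        by (rule wedge_entry[OF I that(2)]) (rule basis_vec_mem(3)[OF J that(1)])
      have "wedge F k N v I = leibniz k (\<lambda>j. ?M (\<tau> j))"
        unfolding wedge_apply[OF I]
      proof (rule leibniz_cong)
        show "?M (\<tau> j) i \<in> carrier F" if "j < k" "i < k" for i j
          using Mc permutes_lessThan[OF \<tau> that(1)] that(2) .
      qed (simp add: s\<tau> v)
      also have "\<dots> = perm_sign F \<tau> \<otimes> leibniz k ?M"
        by (rule leibniz_permute_rows[OF Mc \<tau>])
      finally show "wedge F k N v I = (perm_sign F \<tau> \<odot>\<^bsub>Fn (k_subsets N k)\<^esub> basis_wedge J) I"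
        using I by (simp add: smult_Fn basis_wedge_def wedge_apply)
    qed (use basis_wedge_closed[OF J] in simp)
    then show ?thesis using DE(4) E(2) J by auto
  qed
qed

text \<open>Multilinear expansion, one slot at a time. In the induction the first n slots may hold
  any vectors of \<open>H\<close>, while the slots from n on hold dual basis vectors; n = k covers
  all generators.\<close>

lemma ext_power_sub_subset:
  assumes E: "submodule F E (Fn (k_subsets N k))" "basis_wedge ` pivot_subsets \<subseteq> E"
  shows "ext_power_sub F k N H \<subseteq> E"
proof -
  interpret W: vectorspace F "Fn (k_subsets N k)" by (rule vectorspace_Fn)
  have "wedge F k N v \<in> E" if "n \<le> k" "\<And>j. j < k \<Longrightarrow> v j \<in> H" "\<And>j. n \<le> j \<Longrightarrow> j < k \<Longrightarrow> v j \<in> b ` P"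
    for n v
    using that
  proof (induction n arbitrary: v)
    case 0
    have "\<exists>p. p \<in> P \<and> v j = b p" if "j < k" for j
    proof -
      have "v j \<in> b ` P" by (rule "0.prems"(3)[OF le0 that])
      then show ?thesis by blast
    qed
    then have "\<forall>j\<in>{..<k}. \<exists>p. p \<in> P \<and> v j = b p" by simp
    then obtain f where "\<forall>j\<in>{..<k}. f j \<in> P \<and> v j = b (f j)"
      by (rule bchoice[THEN exE])
    then have f: "f j \<in> P" "v j = b (f j)" if "j < k" for j using that by simp_all
    show ?case by (rule wedge_basis_vecs[OF E f])
  next
    case (Suc n)
    have n: "n < k" using Suc.prems(1) by simp
    \<comment> \<open>The vectors allowed in slot n form a subspace. By the induction hypothesis it
      contains every \<open>b p\<close>, hence also \<open>v n\<close>, which is a combination of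
      them.\<close>
    let ?T = "{x \<in> H. wedge F k N (v(n := x)) \<in> E}"
    have T: "submodule F ?T (Fn {..<N})"
      by (rule wedge_slot_submodule[OF H E(1) Suc.prems(2) n])
    have bT: "b p \<in> ?T" if "p \<in> P" for p
    proof -
      have bH: "b p \<in> H" using pivot_mem[OF H _ P that] by simp
      have "wedge F k N (v(n := b p)) \<in> E"
      proof (rule Suc.IH)
        show "(v(n := b p)) j \<in> H" if "j < k" for j
          using bH Suc.prems(2)[OF that] by simp
        show "(v(n := b p)) j \<in> b ` P" if "n \<le> j" "j < k" for j
          using Suc.prems(3)[of j] that \<open>p \<in> P\<close> by (cases "j = n") simp_all
      qed (use n in simp)
      then show ?thesis using bH by simp
    qed
    have vn: "v n p \<in> carrier F" if "p \<in> P" for p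
      using submodule_FnD(1)[OF H] Suc.prems(2)[OF n] pivot_subset[OF H _ P] that
      by (auto simp: carrier_Fn PiE_iff)
    have "pivot_comb {..<N} P b (v n) \<in> ?T"
      unfolding pivot_comb_def
      by (intro submodule_finsum[OF T] submodule_FnD(4)[OF T] bT vn)
    then have "v n \<in> ?T"
      using pivot_expand[OF H _ P Suc.prems(2)[OF n]] by simp
    then show ?case by simp
  qed
  from this[of k] have "{wedge F k N v |v. \<forall>j<k. v j \<in> H} \<subseteq> E" by auto
  then show ?thesis
    unfolding ext_power_sub_eq using W.span_is_subset E(1) by blast
qed

text \<open>This brings the exterior power of \<open>H\<close> under
  \<open>card_lin_maps_vanishing\<close>. Duality is \<open>basis_wedge_delta\<close>; separation
  follows from it, because the coefficients of a combination of the \<open>basis_wedge J\<close> are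
  its coordinates at the pivots J.\<close>

lemma pivots_ext_power_sub:
  "pivots (k_subsets N k) (ext_power_sub F k N H) pivot_subsets basis_wedge"
proof -
  interpret W: vectorspace F "Fn (k_subsets N k)" by (rule vectorspace_Fn)
  let ?B = "basis_wedge ` pivot_subsets"
  have BC: "?B \<subseteq> carrier (Fn (k_subsets N k))" using basis_wedge_closed by blast
  have inj: "inj_on basis_wedge pivot_subsets"
    using basis_wedge_delta one_not_zero by (intro inj_onI) metis
  have sub: "ext_power_sub F k N H \<subseteq> W.span ?B"
    by (rule ext_power_sub_subset) (use W.span_is_submodule[OF BC] W.in_own_span[OF BC] in auto)
  have sep: "u = \<zero>\<^bsub>Fn (k_subsets N k)\<^esub>"
    if u: "u \<in> W.span ?B" and z: "\<forall>J\<in>pivot_subsets. u J = \<zero>" for u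
  proof -
    from u obtain a where a: "a \<in> ?B \<rightarrow> carrier F" and ua: "u = W.lincomb a ?B"
      using W.finite_span[of ?B] BC finite_pivot_subsets by auto
    let ?f = "\<lambda>J. a (basis_wedge J) \<odot>\<^bsub>Fn (k_subsets N k)\<^esub> basis_wedge J"
    have fc: "?f \<in> pivot_subsets \<rightarrow> carrier (Fn (k_subsets N k))"
      using a basis_wedge_closed by auto
    have u_eq: "u = (\<Oplus>\<^bsub>Fn (k_subsets N k)\<^esub>J\<in>pivot_subsets. ?f J)"
      unfolding ua W.lincomb_def
      by (rule W.finsum_reindex) (use a BC inj in auto)
    have ac: "a (basis_wedge J) \<in> carrier F" if "J \<in> pivot_subsets" for J
      using a that by blast
    have "a (basis_wedge J) = \<zero>" if J: "J \<in> pivot_subsets" for J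
    proof -
      have JS: "J \<in> k_subsets N k" using J pivot_subsets_subset by blast
      have "u J = (\<Oplus>I\<in>pivot_subsets. ?f I J)"
        unfolding u_eq by (rule finsum_Fn_apply[OF fc JS finite_pivot_subsets])
      also have "\<dots> = a (basis_wedge J)"
        using J JS
        by (intro finsum_delta[OF finite_pivot_subsets J]) (simp_all add: ac smult_Fn basis_wedge_delta)
      finally show ?thesis using z J by simp
    qed
    then have "u = (\<Oplus>\<^bsub>Fn (k_subsets N k)\<^esub>J\<in>pivot_subsets. \<zero>\<^bsub>Fn (k_subsets N k)\<^esub>)"
      unfolding u_eq using basis_wedge_closed by (intro W.finsum_cong') auto
    then show ?thesis by simp
  qed
  have mem: "basis_wedge J \<in> ext_power_sub F k N H" if "J \<in> pivot_subsets" for J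
    unfolding basis_wedge_def using basis_vec_mem(2)[OF that] by (rule wedge_in_ext_power_sub)
  show ?thesis
    unfolding pivots_def
  proof (intro conjI ballI impI)
    show "u = \<zero>\<^bsub>Fn (k_subsets N k)\<^esub>"
      if "u \<in> ext_power_sub F k N H" "\<forall>J\<in>pivot_subsets. u J = \<zero>" for u
      using sep[OF subsetD[OF sub that(1)] that(2)] .
  qed (simp_all add: pivot_subsets_subset mem basis_wedge_delta)
qed

end
end

section \<open>Moments of the number of null subspaces\<close>

lemma card_eq_sum_indicator: "finite A \<Longrightarrow> real (card {x \<in> A. P x}) = (\<Sum>x\<in>A. if P x then 1 else 0)"
  by (simp add: sum.If_cases Int_def)

text \<open>Turns a falling factorial into a count of ordered tuples, on which inclusions and
  disjointness can act. If t exceeds |A| the product is zero through its factor i = |A|, in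
  agreement with the absence of such lists.\<close>

lemma card_distinct_lists:
  assumes "finite A"
  shows "real (card {xs. length xs = t \<and> distinct xs \<and> set xs \<subseteq> A}) = falling_factorial (real (card A)) t"
proof (induction t)
  case 0
  have "{xs. length xs = 0 \<and> distinct xs \<and> set xs \<subseteq> A} = {[]}" by auto
  then show ?case by (simp add: falling_factorial_def)
next
  case (Suc t)
  let ?L = "\<lambda>t. {xs. length xs = t \<and> distinct xs \<and> set xs \<subseteq> A}"
  have fin: "finite (?L t)"
    by (rule finite_subset[OF _ finite_lists_length_eq[OF assms, of t]]) auto
  have "?L (Suc t) = (\<lambda>(xs, x). x # xs) ` (SIGMA xs:?L t. A - set xs)"
    by (auto simp: length_Suc_conv image_iff)
  moreover have "inj_on (\<lambda>(xs, x). x # xs) (SIGMA xs:?L t. A - set xs)"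
    by (auto simp: inj_on_def)
  ultimately have "card (?L (Suc t)) = card (SIGMA xs:?L t. A - set xs)"
    by (simp add: card_image)
  also have "\<dots> = (\<Sum>xs\<in>?L t. card (A - set xs))"
    using fin assms by (intro card_SigmaI) auto
  finally have "real (card (?L (Suc t))) = (\<Sum>xs\<in>?L t. real (card (A - set xs)))" by simp
  also have "\<dots> = (\<Sum>xs\<in>?L t. real (card A) - real t)"
  proof (rule sum.cong)
    fix xs assume xs: "xs \<in> ?L t"
    then have "card (set xs) = t" by (simp add: distinct_card)
    moreover have "card (set xs) \<le> card A" using xs assms by (simp add: card_mono)
    ultimately show "real (card (A - set xs)) = real (card A) - real t"
      using xs by (simp add: card_Diff_subset of_nat_diff)
  qed simp
  finally show ?case using Suc.IH by (simp add: falling_factorial_def mult.commute)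
qed

context fin_field begin

section \<open>The probability that a subspace is null\<close>

lemma module_Fn: "Module.module F (Fn S)"
  by (rule func_space_is_module)

lemma card_k_subsets: "card (k_subsets N k) = N choose k"
  unfolding k_subsets_def using n_subsets[of "{..<N}" k] by simp

text \<open>The case of the zero subspace: its pivot set is empty, so no value of a dual basis is
  consulted, and the vanishing condition holds for every linear map.\<close>

lemma card_lin_maps:
  "card (lin_maps F (ext_power F k N) (coord_space F m)) = q ^ (m * (N choose k))"
proof -
  let ?S = "k_subsets N k"
  interpret V: vectorspace F "Fn ?S" by (rule vectorspace_Fn)
  have sub: "submodule F {\<zero>\<^bsub>Fn ?S\<^esub>} (Fn ?S)" by (rule submodule_FnI) auto
  have piv: "pivots ?S {\<zero>\<^bsub>Fn ?S\<^esub>} {} undefined" by (simp add: pivots_def)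
  have "\<Theta> \<zero>\<^bsub>Fn ?S\<^esub> = \<zero>\<^bsub>Fn {..<m}\<^esub>"
    if "\<Theta> \<in> lin_maps F (Fn ?S) (Fn {..<m})" for \<Theta>
  proof -
    interpret \<Theta>: mod_hom F "Fn ?S" "Fn {..<m}" \<Theta>
      by (rule lin_maps_hom[OF finite_k_subsets module_Fn that])
    show ?thesis by simp
  qed
  then have "{\<Theta> \<in> lin_maps F (Fn ?S) (Fn {..<m}). \<forall>w\<in>{\<zero>\<^bsub>Fn ?S\<^esub>}. \<Theta> w = \<zero>\<^bsub>Fn {..<m}\<^esub>} =
      lin_maps F (Fn ?S) (Fn {..<m})" by auto
  then show ?thesis
    using card_lin_maps_vanishing[OF finite_k_subsets module_Fn[of "{..<m}"] sub piv]
    by (simp add: card_carrier_Fn card_k_subsets power_mult)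
qed

lemma finite_lin_maps: "finite (lin_maps F (ext_power F k N) (coord_space F m))"
  and lin_maps_nonempty: "lin_maps F (ext_power F k N) (coord_space F m) \<noteq> {}"
proof -
  have "card (lin_maps F (ext_power F k N) (coord_space F m)) > 0"
    using q_ge_2 by (simp add: card_lin_maps)
  then show "finite (lin_maps F (ext_power F k N) (coord_space F m))"
    "lin_maps F (ext_power F k N) (coord_space F m) \<noteq> {}"
    by (auto simp: card_gt_0_iff)
qed

text \<open>The k-subsets of the s pivots of \<open>H\<close> are pivots of its exterior power, so
  binom(s,k) of the binom(N,k) coordinate values of a map are forced, each in a space of q^m
  elements. The quotient form displays the probability once the total number of maps is divided
  out.\<close>

lemma card_null_lin_maps:
  assumes H: "submodule F H (coord_space F N)" and s: "card H = q ^ s"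
  shows "real (card {\<Theta> \<in> lin_maps F (ext_power F k N) (coord_space F m). null_subspace F k m N \<Theta> H}) =
    real q ^ (m * (N choose k)) / real q ^ (m * (s choose k))"
proof -
  obtain P b where P: "pivots {..<N} H P b" using pivots_exist[OF H] by auto
  have "q ^ card P = q ^ s" using card_pivots[OF H _ P] s by simp
  then have cP: "card P = s" using q_ge_2 by (simp add: power_inject_exp)
  let ?Q = "pivot_subsets k P"
  have cQ: "card ?Q = s choose k" using card_pivot_subsets[OF H P] cP by simp
  have le: "card ?Q \<le> N choose k"
    using card_mono[OF finite_k_subsets pivot_subsets_subset[OF H P], of k] by (simp add: card_k_subsets)
  have "card {\<Theta> \<in> lin_maps F (ext_power F k N) (coord_space F m). null_subspace F k m N \<Theta> H} =
      (q ^ m) ^ ((N choose k) - (s choose k))"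
    using card_lin_maps_vanishing[OF finite_k_subsets module_Fn[of "{..<m}"]
        submodule_ext_power_sub[OF H P] pivots_ext_power_sub[OF H P]]
    by (simp add: null_subspace_def card_carrier_Fn card_k_subsets cQ)
  moreover have "real q ^ (m * ((N choose k) - (s choose k))) =
      real q ^ (m * (N choose k)) / real q ^ (m * (s choose k))"
    using le cQ q_ge_2 by (subst diff_mult_distrib2, subst power_diff) auto
  ultimately show ?thesis by (simp flip: power_mult)
qed

lemma finite_subspaces_dim: "finite S \<Longrightarrow> finite (subspaces_dim F (Fn S) s)"
  by (rule finite_subset[of _ "Pow (carrier (Fn S))"])
    (auto simp: subspaces_dim_Fn finite_carrier_Fn dest: submodule_FnD(1))

lemma expectation_random_map:
  fixes f :: "_ \<Rightarrow> real"
  shows "measure_pmf.expectation (random_map F k m N) f =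
    (\<Sum>\<Theta>\<in>lin_maps F (ext_power F k N) (coord_space F m). f \<Theta>) / real q ^ (m * (N choose k))"
  unfolding random_map_def
  using finite_lin_maps lin_maps_nonempty
  by (subst integral_pmf_of_set) (simp_all add: card_lin_maps)

text \<open>Linearity of expectation; the formula is exact because the probability of being null
  depends on the dimension alone.\<close>

lemma mean_null_eq:
  "mean_null F k m N s =
    real (card (subspaces_dim F (coord_space F N) s)) / real q ^ (m * (s choose k))"
proof -
  let ?G = "subspaces_dim F (coord_space F N) s"
  let ?L = "lin_maps F (ext_power F k N) (coord_space F m)"
  have finG: "finite ?G" by (simp add: finite_subspaces_dim)
  have "(\<Sum>\<Theta>\<in>?L. real (num_null F k m N s \<Theta>)) =
      (\<Sum>\<Theta>\<in>?L. \<Sum>H\<in>?G. if null_subspace F k m N \<Theta> H then 1 else 0)"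
    by (simp add: num_null_def card_eq_sum_indicator[OF finG])
  also have "\<dots> = (\<Sum>H\<in>?G. \<Sum>\<Theta>\<in>?L. if null_subspace F k m N \<Theta> H then 1 else 0)"
    by (rule sum.swap)
  also have "\<dots> = (\<Sum>H\<in>?G. real q ^ (m * (N choose k)) / real q ^ (m * (s choose k)))"
  proof (rule sum.cong)
    fix H assume "H \<in> ?G"
    then have H: "submodule F H (coord_space F N)" "card H = q ^ s"
      by (simp_all add: subspaces_dim_Fn)
    show "(\<Sum>\<Theta>\<in>?L. if null_subspace F k m N \<Theta> H then 1 else 0) =
        real q ^ (m * (N choose k)) / real q ^ (m * (s choose k))"
      using card_null_lin_maps[OF H] card_eq_sum_indicator[OF finite_lin_maps] by simp
  qed simp
  finally have "(\<Sum>\<Theta>\<in>?L. real (num_null F k m N s \<Theta>)) =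
      real (card ?G) * (real q ^ (m * (N choose k)) / real q ^ (m * (s choose k)))" by simp
  then show ?thesis
    unfolding mean_null_def expectation_random_map using q_ge_2 by simp
qed

section \<open>Hyperplanes of null spaces and the factorial moment\<close>

lemma card_hyperplanes:
  assumes S: "finite S" and W: "submodule F W (Fn S)" "card W = q ^ (r + 1)"
  shows "real (card {H \<in> subspaces_dim F (Fn S) r. H \<subseteq> W}) = L_const (real q) r"
proof -
  let ?c = "card {H \<in> subspaces_dim F (Fn S) r. H \<subseteq> W}"
  let ?x = "real q"
  have x: "?x \<ge> 2" using q_ge_2 by simp
  have real_prod: "real (\<Prod>j<r. q ^ n - q ^ j) = (\<Prod>j<r. ?x ^ n - ?x ^ j)" if "r \<le> n" for n
    using that q_ge_2 by (auto simp: of_nat_diff power_increasing intro!: prod.cong)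
  define D where "D = (\<Prod>j<r. ?x ^ r - ?x ^ j)"
  have D: "D \<noteq> 0"
    using x by (auto simp: D_def power_inject_exp)
  have "real ?c * D = (\<Prod>j<r. ?x ^ (r + 1) - ?x ^ j)"
    using arg_cong[OF card_subspaces[OF S W, of r], of real]
    unfolding of_nat_mult real_prod[OF order.refl] real_prod[OF le_add1] D_def .
  \<comment> \<open>The factor q^r (q-1) is the missing term j = r of the product. With it, an index
    shift splits off the term j = 0, which is q^(r+1) - 1, and leaves q times each factor of
    \<open>D\<close>.\<close>
  then have "real ?c * D * (?x ^ r * (?x - 1)) = (\<Prod>j<Suc r. ?x ^ (r + 1) - ?x ^ j)"
    by (simp add: algebra_simps)
  also have "\<dots> = (?x ^ (r + 1) - 1) * (\<Prod>j<r. ?x * (?x ^ r - ?x ^ j))"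
    by (subst prod.lessThan_Suc_shift) (simp add: algebra_simps)
  also have "\<dots> = (?x ^ (r + 1) - 1) * (?x ^ r * D)"
    by (simp add: prod.distrib D_def)
  finally have "(?x ^ r * D) * (real ?c * (?x - 1)) = (?x ^ r * D) * (?x ^ (r + 1) - 1)"
    by (simp add: mult_ac)
  then have "real ?c * (?x - 1) = ?x ^ (r + 1) - 1"
    using D x by (subst (asm) mult_cancel_left) auto
  then show ?thesis using x by (simp add: L_const_def field_simps)
qed

lemma null_subspace_mono:
  assumes "submodule F W (coord_space F N)" "H \<subseteq> W" "null_subspace F k m N \<Theta> W"
  shows "null_subspace F k m N \<Theta> H"
proof -
  interpret V: vectorspace F "ext_power F k N" by (rule vectorspace_Fn)
  have "ext_power_sub F k N H \<subseteq> ext_power_sub F k N W"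
    unfolding ext_power_sub_def using assms(2) by (intro V.span_is_monotone) blast
  then show ?thesis using assms(3) by (auto simp: null_subspace_def)
qed

lemma submodule_Int:
  "submodule F U (Fn S) \<Longrightarrow> submodule F W (Fn S) \<Longrightarrow> submodule F (U \<inter> W) (Fn S)"
  by (auto simp: submodule_def)

text \<open>Two distinct hyperplanes of an \<open>(r + 1)\<close>-dimensional space determine it, so the
  \<open>t\<close>-tuples of hyperplanes of different null \<open>(r + 1)\<close>-spaces are different.\<close>

lemma hyperplane_pair_unique:
  assumes S: "finite S"
    and U: "U \<in> subspaces_dim F (Fn S) (r + 1)" and W: "W \<in> subspaces_dim F (Fn S) (r + 1)"
    and H: "H \<in> subspaces_dim F (Fn S) r" "H' \<in> subspaces_dim F (Fn S) r" "H \<noteq> H'"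
    and sub: "H \<subseteq> U \<inter> W" "H' \<subseteq> U \<inter> W"
  shows "U = W"
proof -
  note [simp] = subspaces_dim_Fn[OF S]
  have fin: "finite U" "finite W" using U W finite_submodule S by auto
  obtain i where i: "card (U \<inter> W) = q ^ i"
    using card_submodule[OF submodule_Int S, of U W] U W by auto
  have "H \<subset> U \<inter> W"
  proof (rule ccontr)
    assume "\<not> ?thesis"
    then have "H = U \<inter> W" using sub by blast
    moreover have "card H = card H'" using H by simp
    ultimately have "H' = H" using sub fin by (intro card_subset_eq) auto
    then show False using H(3) by simp
  qed
  then have "card H < card (U \<inter> W)" using fin by (intro psubset_card_mono) auto
  \<comment> \<open>Dimensions are integers: an intersection larger than a hyperplane already has
    the full size q^(r+1) of \<open>U\<close> and of \<open>W\<close>.\<close>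
  then have "q ^ r < q ^ i" using H i by simp
  then have "r < i" using q_ge_2 by (simp add: power_strict_increasing_iff)
  then have le: "q ^ (r + 1) \<le> card (U \<inter> W)" unfolding i using q_ge_2 by (intro power_increasing) auto
  have "U \<inter> W = U" by (rule card_seteq) (use le U fin in auto)
  moreover have "U \<inter> W = W" by (rule card_seteq) (use le W fin in auto)
  ultimately show ?thesis by simp
qed

lemma num_null_falling_factorial:
  assumes t: "t \<ge> 2"
  shows "falling_factorial (real (num_null F k m N r \<Theta>)) t \<ge>
    real (num_null F k m N (r + 1) \<Theta>) * falling_factorial (L_const (real q) r) t"
proof -
  define A where "A = {H \<in> subspaces_dim F (coord_space F N) r. null_subspace F k m N \<Theta> H}"
  define B where "B = {W \<in> subspaces_dim F (coord_space F N) (r + 1). null_subspace F k m N \<Theta> W}"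
  define hyp where "hyp W = {H \<in> subspaces_dim F (coord_space F N) r. H \<subseteq> W}" for W
  define tuples where "tuples C = {xs. length xs = t \<and> distinct xs \<and> set xs \<subseteq> C}"
    for C :: "(nat \<Rightarrow> 'a) set set"
  have fin: "finite A" "finite B" "finite (hyp W)" for W
    by (simp_all add: A_def B_def hyp_def finite_subspaces_dim)
  have fint: "finite (tuples C)" if "finite C" for C
    unfolding tuples_def by (rule finite_subset[OF _ finite_lists_length_eq[OF that, of t]]) auto
  have "tuples (hyp W) \<subseteq> tuples A" if W: "W \<in> B" for W
  proof -
    have "submodule F W (coord_space F N)" using W by (simp add: B_def subspaces_dim_Fn)
    then have "hyp W \<subseteq> A"
      using W null_subspace_mono by (auto simp: hyp_def A_def B_def)
    then show ?thesis by (auto simp: tuples_def)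
  qed
  then have "card (\<Union>W\<in>B. tuples (hyp W)) \<le> card (tuples A)"
    using fint fin by (intro card_mono) auto
  moreover have "card (\<Union>W\<in>B. tuples (hyp W)) = (\<Sum>W\<in>B. card (tuples (hyp W)))"
  proof (rule card_UN_disjoint)
    show "\<forall>U\<in>B. \<forall>W\<in>B. U \<noteq> W \<longrightarrow> tuples (hyp U) \<inter> tuples (hyp W) = {}"
    proof (intro ballI impI equals0I)
      fix U W xs assume UW: "U \<in> B" "W \<in> B" "U \<noteq> W" and "xs \<in> tuples (hyp U) \<inter> tuples (hyp W)"
      then have xs: "length xs = t" "distinct xs" "set xs \<subseteq> hyp U" "set xs \<subseteq> hyp W"
        by (auto simp: tuples_def)
      \<comment> \<open>Here t \<ge> 2 is used: two distinct entries of the tuple are enough to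
        recover the null space containing them.\<close>
      have m: "xs ! 0 \<in> set xs" "xs ! 1 \<in> set xs" using xs(1) t by auto
      have ne: "xs ! 0 \<noteq> xs ! 1" using xs(1,2) t by (simp add: nth_eq_iff_index_eq)
      have "U = W"
      proof (rule hyperplane_pair_unique[OF finite_lessThan _ _ _ _ ne])
        have h: "xs ! 0 \<in> hyp U" "xs ! 0 \<in> hyp W" "xs ! 1 \<in> hyp U" "xs ! 1 \<in> hyp W"
          using m xs by blast+
        then show "xs ! 0 \<in> subspaces_dim F (coord_space F N) r"
          "xs ! 1 \<in> subspaces_dim F (coord_space F N) r"
          "xs ! 0 \<subseteq> U \<inter> W" "xs ! 1 \<subseteq> U \<inter> W" by (simp_all add: hyp_def)
      qed (use UW in \<open>simp_all add: B_def\<close>)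
      then show False using UW by simp
    qed
  qed (use fin fint in auto)
  ultimately have "(\<Sum>W\<in>B. real (card (tuples (hyp W)))) \<le> real (card (tuples A))"
    by (simp flip: of_nat_sum)
  moreover have "real (card (tuples (hyp W))) = falling_factorial (L_const (real q) r) t"
    if W: "W \<in> B" for W
  proof -
    have "submodule F W (coord_space F N)" "card W = q ^ (r + 1)"
      using W by (simp_all add: B_def subspaces_dim_Fn)
    then have "real (card (hyp W)) = L_const (real q) r"
      unfolding hyp_def by (intro card_hyperplanes) auto
    then show ?thesis using card_distinct_lists[OF fin(3), of t W] by (simp add: tuples_def)
  qed
  moreover have "real (card (tuples A)) = falling_factorial (real (num_null F k m N r \<Theta>)) t"
    using card_distinct_lists[OF fin(1), of t] by (simp add: tuples_def A_def num_null_def)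
  moreover have "card B = num_null F k m N (r + 1) \<Theta>" by (simp add: B_def num_null_def)
  ultimately show ?thesis by simp
qed

lemma factorial_moment_null_ge:
  assumes "t \<ge> 2"
  shows "factorial_moment_null F k m N r t \<ge>
    mean_null F k m N (r + 1) * falling_factorial (L_const (real q) r) t"
proof -
  let ?L = "lin_maps F (ext_power F k N) (coord_space F m)"
  have "(\<Sum>\<Theta>\<in>?L. real (num_null F k m N (r + 1) \<Theta>)) * falling_factorial (L_const (real q) r) t \<le>
      (\<Sum>\<Theta>\<in>?L. falling_factorial (real (num_null F k m N r \<Theta>)) t)"
    unfolding sum_distrib_right by (intro sum_mono num_null_falling_factorial assms)
  then show ?thesis
    unfolding factorial_moment_null_def mean_null_def expectation_random_map
    by (simp add: divide_right_mono)
qed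

end

section \<open>Estimates\<close>

definition partial_C :: "real \<Rightarrow> nat \<Rightarrow> real" where
  "partial_C x s = (\<Prod>j<s. inverse (1 - x powr - real (Suc j)))"

lemma powr_neg_nat: "x > 0 \<Longrightarrow> x powr - real n = (1 / x) ^ n"
  by (simp add: powr_minus powr_realpow power_one_over inverse_eq_divide)

lemma powr_neg_Suc_le_half:
  assumes "x \<ge> (2::real)"
  shows "x powr - real (Suc j) \<le> 1 / 2" "x powr - real (Suc j) > 0"
proof -
  have "x powr - real (Suc j) \<le> x powr - 1" using assms by (intro powr_mono) auto
  also have "\<dots> \<le> 1 / 2" using assms by (simp add: powr_minus field_simps)
  finally show "x powr - real (Suc j) \<le> 1 / 2" .
qed (use assms in simp)

text \<open>All factors are at least 1, so the partial products stay below the infinite product once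
  that converges. Convergence follows from 1/(1-y) - 1 \<le> 2y for 0 < y \<le> 1/2 and a geometric
  series.\<close>

lemma partial_C_le_C_const:
  assumes "x \<ge> 2"
  shows "partial_C x s \<le> C_const x"
proof -
  let ?f = "\<lambda>j. inverse (1 - x powr - real (Suc j))"
  note h = powr_neg_Suc_le_half[OF assms]
  have ge1: "?f j \<ge> 1" for j using h[of j] by (simp add: field_simps)
  have "summable (\<lambda>j. norm (?f j - 1))"
  proof (rule summable_comparison_test')
    have "summable (\<lambda>j. (1 / x) ^ j)" using assms by (intro summable_geometric) auto
    then show "summable (\<lambda>j. 2 * (1 / x) ^ Suc j)" by (intro summable_mult) (simp add: summable_Suc_iff)
    fix j :: nat
    have p: "x powr - real (Suc j) = (1 / x) ^ Suc j"
      using assms by (intro powr_neg_nat) simp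
    define y where "y = x powr - real (Suc j)"
    have y: "0 < y" "y \<le> 1 / 2" using h[of j] by (simp_all add: y_def)
    have "norm (?f j - 1) = ?f j - 1" using ge1[of j] by simp
    also have "\<dots> = y / (1 - y)" using y by (simp add: y_def field_simps)
    also have "\<dots> \<le> y / (1 / 2)" using y by (intro divide_left_mono) auto
    finally show "norm (norm (?f j - 1)) \<le> 2 * (1 / x) ^ Suc j"
      unfolding p[symmetric] y_def[symmetric] by simp
  qed
  then have "convergent_prod ?f"
    by (intro abs_convergent_prod_imp_convergent_prod summable_imp_abs_convergent_prod)
  then have "?f has_prod prodinf ?f" by (rule convergent_prod_has_prod)
  then show ?thesis
    unfolding partial_C_def C_const_def
    by (rule prod_le_prodinf) (rule order_trans[OF zero_le_one ge1], rule ge1)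
qed

lemma partial_C_le_4:
  assumes x: "x \<ge> 2"
  shows "partial_C x s \<le> 4"
proof -
  \<comment> \<open>The bare bound 1/4 is not inductive. The surplus 2^(-s)/4 pays for the next
    factor 1 - 2^(-s-2), and the strengthened bound holds with equality at s = 0.\<close>
  have *: "(\<Prod>j<Suc s. 1 - (1 / 2) ^ Suc j) \<ge> (1 / 4) * (1 + (1 / 2) ^ s :: real)" for s
  proof (induction s)
    case (Suc s)
    let ?y = "(1 / 2) ^ s :: real"
    have y: "0 \<le> ?y" "?y \<le> 1" by (simp_all add: power_le_one)
    have "(1 / 4) * (1 + ?y / 2) \<le> (1 / 4) * (1 + ?y) * (1 - ?y / 4)"
      using y mult_mono[of ?y 1 ?y ?y] by (simp add: algebra_simps)
    also have "\<dots> \<le> (\<Prod>j<Suc s. 1 - (1 / 2) ^ Suc j) * (1 - ?y / 4)"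
      using Suc.IH y by (intro mult_right_mono) auto
    finally show ?case by (simp add: mult.commute)
  qed simp
  have "(\<Prod>j<s. 1 - (1 / 2) ^ Suc j) \<ge> (1 / 4 :: real)"
  proof (cases s)
    case (Suc n)
    have "(1 / 4) * (1 + (1 / 2) ^ n) \<ge> (1 / 4 :: real)" by simp
    then show ?thesis using *[of n] unfolding Suc by (rule order_trans)
  qed simp
  also have "(\<Prod>j<s. 1 - (1 / 2 :: real) ^ Suc j) \<le> (\<Prod>j<s. 1 - x powr - real (Suc j))"
  proof (rule prod_mono)
    fix j assume "j \<in> {..<s}"
    have "x powr - real (Suc j) = (1 / x) ^ Suc j"
      using x by (intro powr_neg_nat) simp
    also have "\<dots> \<le> (1 / 2) ^ Suc j"
      using x by (intro power_mono) (auto simp: field_simps)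
    finally show "0 \<le> 1 - (1 / 2 :: real) ^ Suc j \<and> 1 - (1 / 2) ^ Suc j \<le> 1 - x powr - real (Suc j)"
      by (auto intro!: power_le_one simp del: power_Suc)
  qed
  finally have "1 / 4 \<le> (\<Prod>j<s. 1 - x powr - real (Suc j))" .
  then have "inverse (\<Prod>j<s. 1 - x powr - real (Suc j)) \<le> inverse (1 / 4)"
    by (intro le_imp_inverse_le) auto
  moreover have "partial_C x s = inverse (\<Prod>j<s. 1 - x powr - real (Suc j))"
    unfolding partial_C_def by (induction s) simp_all
  ultimately show ?thesis by simp
qed

text \<open>Here c is the Gaussian binomial coefficient, characterised by the double count. Each of
  its s factors (x^n - x^j)/(x^s - x^j) lies between x^(n-s) and x^(n-s)/(1 - x^(j-s)).\<close>

lemma gauss_binomial_bounds: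
  fixes x c :: real
  assumes x: "x \<ge> 2" and s: "s \<le> n"
    and c: "c * (\<Prod>j<s. x ^ s - x ^ j) = (\<Prod>j<s. x ^ n - x ^ j)"
  shows "x ^ (s * (n - s)) \<le> c" and "c \<le> x ^ (s * (n - s)) * partial_C x s"
proof -
  have pos: "x ^ s - x ^ j > 0" if "j < s" for j
    using that x by (simp add: power_strict_increasing)
  then have D: "(\<Prod>j<s. x ^ s - x ^ j) > 0" by (intro prod_pos) auto
  then have ce: "c = (\<Prod>j<s. (x ^ n - x ^ j) / (x ^ s - x ^ j))"
    using c by (simp add: prod_dividef eq_divide_eq less_imp_neq[symmetric])
  have pw: "x ^ (s * (n - s)) = (\<Prod>j<s. x ^ (n - s))"
    by (simp add: mult.commute flip: power_mult)
  have n: "x ^ n = x ^ (n - s) * x ^ s" using s by (simp flip: power_add)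
  show "x ^ (s * (n - s)) \<le> c"
    unfolding ce pw
  proof (rule prod_mono, safe)
    fix j assume "j < s"
    have "1 * x ^ j \<le> x ^ (n - s) * x ^ j" using x by (intro mult_right_mono) auto
    then have "x ^ (n - s) * (x ^ s - x ^ j) \<le> x ^ n - x ^ j" by (simp add: n algebra_simps)
    then show "x ^ (n - s) \<le> (x ^ n - x ^ j) / (x ^ s - x ^ j)"
      using pos[OF \<open>j < s\<close>] by (simp add: pos_le_divide_eq)
  qed (use x in simp)
  \<comment> \<open>Reversing the order of the factors pairs index j with the exponent j - s that
    occurs in the j-th quotient.\<close>
  have "partial_C x s = (\<Prod>j<s. inverse (1 - x powr - real (Suc (s - Suc j))))"
    unfolding partial_C_def by (rule prod.nat_diff_reindex[symmetric])
  then have "x ^ (s * (n - s)) * partial_C x s =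
      (\<Prod>j<s. x ^ (n - s) * inverse (1 - x powr - real (Suc (s - Suc j))))"
    by (simp only: pw prod.distrib)
  also have "c \<le> \<dots>"
    unfolding ce
  proof (rule prod_mono, safe)
    fix j assume j: "j < s"
    show "0 \<le> (x ^ n - x ^ j) / (x ^ s - x ^ j)"
      using pos[OF j] x s j by (intro divide_nonneg_pos) (auto intro!: power_increasing)
    have "x powr - real (Suc (s - Suc j)) = x ^ j / x ^ s"
    proof -
      have "- real (Suc (s - Suc j)) = real j - real s" using j by (simp add: of_nat_diff)
      then show ?thesis using x by (simp add: powr_diff powr_realpow)
    qed
    then have "inverse (1 - x powr - real (Suc (s - Suc j))) = x ^ s / (x ^ s - x ^ j)"
      using x pos[OF j] by (simp add: field_simps)
    then have "x ^ (n - s) * inverse (1 - x powr - real (Suc (s - Suc j))) = x ^ n / (x ^ s - x ^ j)"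
      by (simp add: n)
    then show "(x ^ n - x ^ j) / (x ^ s - x ^ j) \<le>
        x ^ (n - s) * inverse (1 - x powr - real (Suc (s - Suc j)))"
      using pos[OF j] x by (simp add: divide_right_mono)
  qed
  finally show "c \<le> x ^ (s * (n - s)) * partial_C x s" .
qed

lemma falling_factorial_ge:
  assumes "real t \<le> L / 2"
  shows "(L / 2) ^ t \<le> falling_factorial L t"
proof -
  have "(\<Prod>i<t. L / 2) \<le> (\<Prod>i<t. L - real i)"
    using assms by (intro prod_mono) auto
  then show ?thesis by (simp add: falling_factorial_def)
qed

lemma L_const_ge:
  assumes "x \<ge> 2"
  shows "x ^ r \<le> L_const x r"
proof -
  have "x ^ r \<ge> 1" using assms by simp
  then have "x ^ r * (x - 1) \<le> x ^ (r + 1) - 1" by (simp add: algebra_simps)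
  then show ?thesis using assms by (simp add: L_const_def pos_le_divide_eq)
qed

text \<open>Every factor is at least L_r/2, hence at least q^r/2 and so q^(r-1). The halving is paid
  with one power of q per factor, which is the source of the O(t) term.\<close>

lemma falling_factorial_L_const_ge:
  assumes x: "x \<ge> 2" and t: "real t \<le> L_const x r / 2"
  shows "x powr (real t * real r - real t) \<le> falling_factorial (L_const x r) t"
proof -
  have "x powr (real t * real r - real t) = (x powr (real r - 1)) powr real t"
    by (simp add: powr_powr algebra_simps)
  also have "\<dots> = (x powr (real r - 1)) ^ t"
    using x by (intro powr_realpow) simp
  also have "\<dots> \<le> (L_const x r / 2) ^ t"
  proof (rule power_mono)
    have "x powr (real r - 1) = x ^ r / x" using x by (simp add: powr_diff powr_realpow)
    also have "\<dots> \<le> x ^ r / 2" using x by (intro divide_left_mono) auto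
    finally show "x powr (real r - 1) \<le> L_const x r / 2" using L_const_ge[OF x, of r] by simp
  qed simp
  also have "\<dots> \<le> falling_factorial (L_const x r) t" by (rule falling_factorial_ge[OF t])
  finally show ?thesis .
qed

section \<open>Arithmetic of the admissible parameters\<close>

lemma admissible_nat:
  assumes "admissible k r m c"
  shows "m * (r choose k) = r * c" "c \<ge> 1" "r \<ge> 2" "k \<le> r" "k \<ge> 2" "m \<ge> 1"
proof -
  have *: "2 \<le> k" "k \<le> r" "1 \<le> m" "real c = real m / real r * real (r choose k)"
    using assms by (auto simp: admissible_def)
  then have "real r * real c = real m * real (r choose k)" by simp
  then have "real (m * (r choose k)) = real (r * c)" by simp
  then show eq: "m * (r choose k) = r * c" by (simp only: of_nat_eq_iff)
  have "m * (r choose k) > 0" using * by simp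
  then show "c \<ge> 1" using eq by (cases c) auto
qed (use assms in \<open>auto simp: admissible_def\<close>)

text \<open>The first summand is (r+1)(N-r-1) for N = r + c, the exponent from counting
  (r+1)-spaces, so \<open>A_const\<close> is the deficit in the first moment. The identity comes
  from (r+1-k) binom(r+1,k) = (r+1) binom(r,k) and m binom(r,k) = r c.\<close>

lemma admissible_exponent:
  assumes "admissible k r m c"
  shows "real (m * ((r + 1) choose k)) = (real r + 1) * (real c - 1) + A_const k c r"
proof -
  note ad = admissible_nat[OF assms]
  have d: "real r + 1 - real k > 0" using ad by simp
  have "((r + 1) - k) * ((r + 1) choose k) = (r + 1) * (r choose k)"
    using binomial_absorb_comp[of "r + 1" k] by simp
  from arg_cong[OF this, of real]
  have "real ((r + 1) - k) * real ((r + 1) choose k) = (real r + 1) * real (r choose k)"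
    unfolding of_nat_mult of_nat_add of_nat_1 .
  moreover have "real ((r + 1) - k) = real r + 1 - real k" using ad by (simp add: of_nat_diff)
  ultimately have "(real r + 1 - real k) * real ((r + 1) choose k) = (real r + 1) * real (r choose k)"
    by (simp only:)
  then have "(real r + 1 - real k) * (real m * real ((r + 1) choose k)) =
      (real r + 1) * (real m * real (r choose k))" by (simp add: mult_ac)
  also have "real m * real (r choose k) = real r * real c"
    using arg_cong[OF ad(1), of real] unfolding of_nat_mult .
  finally have "real m * real ((r + 1) choose k) =
      (real r + 1) * (real r * real c) / (real r + 1 - real k)"
    using d by (simp add: field_simps)
  also have "\<dots> = (real r + 1) * (real c - 1) + A_const k c r"
    using d by (simp add: A_const_def field_simps)
  finally show ?thesis by simp
qed

text \<open>Absorption gives c/(r+1-k) = (m/r) binom(r,k-1)/k, and binom(r,k-1) (k-1)! \<le>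
  r^(k-1). For k = 2 this is an equality and the bound reads (r+1)(m+2)/2.\<close>

lemma admissible_A_const_le:
  assumes "admissible k r m c"
  shows "A_const k c r \<le> (real r + 1) * (1 + (real k - 1) / fact k * (real m * real r ^ (k - 2)))"
proof -
  note ad = admissible_nat[OF assms]
  have d: "real r + 1 - real k > 0" using ad by simp
  have abs: "k * (r choose k) = (r - (k - 1)) * (r choose (k - 1))"
    using binomial_absorption[of "k - 1" r] binomial_absorb_comp[of r "k - 1"] ad by simp
  have "real c * fact k = real m / real r * (real (k * (r choose k)) * fact (k - 1))"
    using assms ad by (simp add: admissible_def fact_reduce[of k])
  also have "real (k * (r choose k)) = (real r + 1 - real k) * real (r choose (k - 1))"
    unfolding abs using ad by (simp add: of_nat_diff)
  finally have "real c * fact k / (real r + 1 - real k) =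
      real m / real r * real ((r choose (k - 1)) * fact (k - 1))"
    using d by simp
  also have "\<dots> \<le> real m / real r * real (r ^ (k - 1))"
    using binomial_fact_pow[of r "k - 1"] by (intro mult_left_mono of_nat_mono) auto
  also have "\<dots> = real m * real r ^ (k - 2)"
  proof -
    have "k - 1 = Suc (k - 2)" using ad by simp
    then show ?thesis using ad by simp
  qed
  finally have "real c / (real r + 1 - real k) \<le> real m * real r ^ (k - 2) / fact k"
    by (simp add: field_simps)
  then have "(real k - 1) * (real c / (real r + 1 - real k)) \<le>
      (real k - 1) * (real m * real r ^ (k - 2) / fact k)"
    using ad by (intro mult_left_mono) auto
  then show ?thesis
    unfolding A_const_def by (intro mult_left_mono add_left_mono) auto
qed

section \<open>Moment bounds for admissible parameters\<close>

lemma finite_field_fin_field: "finite_field F \<longleftrightarrow> fin_field F"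
  by (simp add: finite_field_def fin_field_def fin_field_axioms_def)

context fin_field begin

lemma mean_null_bounds:
  assumes s: "s \<le> N"
  shows "real q ^ (s * (N - s)) / real q ^ (m * (s choose k)) \<le> mean_null F k m N s"
    and "mean_null F k m N s \<le>
      partial_C (real q) s * (real q ^ (s * (N - s)) / real q ^ (m * (s choose k)))"
proof -
  let ?x = "real q" and ?c = "card (subspaces_dim F (coord_space F N) s)"
  have x: "?x \<ge> 2" using q_ge_2 by simp
  have real_prod: "real (\<Prod>j<s. q ^ n - q ^ j) = (\<Prod>j<s. ?x ^ n - ?x ^ j)" if "s \<le> n" for n
    using that q_ge_2 by (auto simp: of_nat_diff power_increasing intro!: prod.cong)
  have sub: "{H \<in> subspaces_dim F (coord_space F N) s. H \<subseteq> carrier (coord_space F N)} =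
      subspaces_dim F (coord_space F N) s"
    by (auto simp: subspaces_dim_Fn dest: submodule_FnD(1))
  have "?c * (\<Prod>j<s. q ^ s - q ^ j) = (\<Prod>j<s. q ^ N - q ^ j)"
    using card_subspaces[OF _ submodule_carrier_Fn, of "{..<N}" N s] unfolding sub
    by (simp add: card_carrier_Fn)
  from arg_cong[OF this, of real]
  have c: "real ?c * (\<Prod>j<s. ?x ^ s - ?x ^ j) = (\<Prod>j<s. ?x ^ N - ?x ^ j)"
    unfolding of_nat_mult real_prod[OF order.refl] real_prod[OF s] .
  note b = gauss_binomial_bounds[OF x s c]
  show "?x ^ (s * (N - s)) / ?x ^ (m * (s choose k)) \<le> mean_null F k m N s"
    unfolding mean_null_eq using b(1) by (rule divide_right_mono) simp
  have "mean_null F k m N s \<le> ?x ^ (s * (N - s)) * partial_C ?x s / ?x ^ (m * (s choose k))"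
    unfolding mean_null_eq using b(2) by (rule divide_right_mono) simp
  then show "mean_null F k m N s \<le> partial_C ?x s * (?x ^ (s * (N - s)) / ?x ^ (m * (s choose k)))"
    by (simp add: mult.commute)
qed

context
  fixes k r m c :: nat
  assumes ad: "admissible k r m c"
begin

lemma q_powr_A_const:
  "real q ^ ((r + 1) * (r + c - (r + 1))) / real q ^ (m * ((r + 1) choose k)) =
    real q powr (- A_const k c r)"
proof -
  have x: "real q > 0" using q_ge_2 by simp
  have e: "real ((r + 1) * (r + c - (r + 1))) = (real r + 1) * (real c - 1)"
  proof -
    \<comment> \<open>The natural subtraction is genuine because c \<ge> 1.\<close>
    have "real (r + c - (r + 1)) = real c - 1"
      using admissible_nat(2)[OF ad] by (simp add: of_nat_diff)
    then show ?thesis by (simp only: of_nat_mult of_nat_add of_nat_1)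
  qed
  have "real q ^ ((r + 1) * (r + c - (r + 1))) / real q ^ (m * ((r + 1) choose k)) =
      real q powr (real ((r + 1) * (r + c - (r + 1))) - real (m * ((r + 1) choose k)))"
    by (simp only: powr_diff powr_realpow[OF x])
  also have "\<dots> = real q powr (- A_const k c r)"
    unfolding e admissible_exponent[OF ad] by simp
  finally show ?thesis .
qed

lemma mean_null_Suc_bounds:
  "real q powr (- A_const k c r) \<le> mean_null F k m (r + c) (r + 1)"
  "mean_null F k m (r + c) (r + 1) \<le> C_const (real q) * real q powr (- A_const k c r)"
proof -
  have s: "r + 1 \<le> r + c" using admissible_nat(2)[OF ad] by simp
  note b = mean_null_bounds[OF s, where m = m and k = k, unfolded q_powr_A_const]
  show "real q powr (- A_const k c r) \<le> mean_null F k m (r + c) (r + 1)" by (rule b(1))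
  have "partial_C (real q) (r + 1) * real q powr (- A_const k c r) \<le>
      C_const (real q) * real q powr (- A_const k c r)"
    using q_ge_2 by (intro mult_right_mono partial_C_le_C_const) auto
  with b(2) show "mean_null F k m (r + c) (r + 1) \<le> C_const (real q) * real q powr (- A_const k c r)"
    by (rule order_trans)
qed

text \<open>At dimension r the number of subspaces contributes q^(rc) and the probability q^(-rc),
  by m binom(r,k) = r c. Only the partial product of C_q remains.\<close>

lemma mean_null_critical:
  "1 \<le> mean_null F k m (r + c) r" "mean_null F k m (r + c) r \<le> 4"
proof -
  have one: "real q ^ (r * (r + c - r)) / real q ^ (m * (r choose k)) = 1"
    using q_ge_2 admissible_nat(1)[OF ad] by simp
  note b = mean_null_bounds[OF le_add1[of r c], where m = m and k = k, unfolded one]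
  show "1 \<le> mean_null F k m (r + c) r" by (rule b(1))
  show "mean_null F k m (r + c) r \<le> 4"
    using b(2) partial_C_le_4[of "real q" r] q_ge_2 by simp
qed

lemma factorial_moment_null_powr_ge:
  assumes t: "t \<ge> 2" "real t \<le> L_const (real q) r / 2"
  shows "real q powr (real t * real r - A_const k c r - real t) \<le>
    factorial_moment_null F k m (r + c) r t"
proof -
  have x: "real q \<ge> 2" using q_ge_2 by simp
  have "real q powr (real t * real r - A_const k c r - real t) =
      real q powr (- A_const k c r) * real q powr (real t * real r - real t)"
    by (simp add: algebra_simps flip: powr_add)
  also have "\<dots> \<le> mean_null F k m (r + c) (r + 1) * falling_factorial (L_const (real q) r) t"
    using mean_null_Suc_bounds(1) falling_factorial_L_const_ge[OF x t(2)]
    by (intro mult_mono) (auto intro: order_trans[OF powr_ge_zero])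
  also have "\<dots> \<le> factorial_moment_null F k m (r + c) r t"
    by (rule factorial_moment_null_ge[OF t(1)])
  finally show ?thesis .
qed

lemma factorial_moment_null_log_ge:
  assumes t: "t \<ge> 2" "real t \<le> L_const (real q) r / 2"
  shows "factorial_moment_null F k m (r + c) r t > 0"
    and "log (real q) (factorial_moment_null F k m (r + c) r t) \<ge>
      real t * real r - A_const k c r - real t"
proof -
  have x: "real q > 1" using q_ge_2 by simp
  note b = factorial_moment_null_powr_ge[OF t]
  show p: "factorial_moment_null F k m (r + c) r t > 0"
    by (rule less_le_trans[OF _ b]) (use x in simp)
  show "log (real q) (factorial_moment_null F k m (r + c) r t) \<ge>
      real t * real r - A_const k c r - real t"
    using b by (simp add: le_log_iff[OF x p])
qed

text \<open>The t-th power of the mean is at most 4^t \<le> q^(2t), so together with the loss q^t in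
  the moment the ratio is at least q^(t(r-3) - A_r). The rest compares exponents.\<close>

lemma factorial_moment_ratio_ge:
  assumes k: "k \<ge> 3" and \<epsilon>: "\<epsilon> > 0"
    and r: "r \<ge> 3" "real r \<ge> 2 * (4 * ((real k - 1) / fact k) + 3 * \<epsilon> + 2) / \<epsilon>"
    and t: "real t \<ge> ((real k - 1) / fact k + \<epsilon>) * real m * real r ^ (k - 2)"
      "real t \<le> L_const (real q) r / 2"
  shows "factorial_moment_null F k m (r + c) r t / mean_null F k m (r + c) r ^ t
      \<ge> real q powr (\<epsilon> / 2 * real m * real r ^ (k - 1))"
proof -
  have x: "real q \<ge> 2" using q_ge_2 by simp
  define a where "a = (real k - 1) / fact k"
  define X where "X = real m * real r ^ (k - 2)"
  have a: "a \<ge> 0" using k by (simp add: a_def)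
  have k1: "k - 1 = Suc (k - 2)" using k by simp
  \<comment> \<open>This is where k \<ge> 3 matters: the power r^(k-2) is at least r, so terms of
    order r are absorbed by multiples of X.\<close>
  have X: "X \<ge> real r"
  proof -
    have "real r ^ 1 \<le> real r ^ (k - 2)" using r(1) k by (intro power_increasing) auto
    then have "1 * real r \<le> real m * real r ^ (k - 2)"
      using admissible_nat(6)[OF ad] by (intro mult_mono) auto
    then show ?thesis by (simp add: X_def)
  qed
  have tX: "real t \<ge> (a + \<epsilon>) * X" using t(1) by (simp add: a_def X_def mult.assoc)
  have r\<epsilon>: "\<epsilon> * real r \<ge> 2 * (4 * a + 3 * \<epsilon> + 2)"
    using r(2) \<epsilon> by (simp add: a_def pos_divide_le_eq mult.commute)
  have "(a + \<epsilon>) * X \<ge> \<epsilon> * real r"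
    using X a \<epsilon> by (intro mult_mono) auto
  moreover have "4 \<le> 2 * (4 * a + 3 * \<epsilon> + 2)" using a \<epsilon> by simp
  \<comment> \<open>The lower bound on r makes t large enough for a pair of hyperplanes, through t
    \<ge> (a + \<epsilon>) X \<ge> \<epsilon> r \<ge> 4.\<close>
  ultimately have "4 \<le> real t" using tX r\<epsilon> by (meson order_trans)
  then have t2: "t \<ge> 2" by simp
  have A: "A_const k c r \<le> (real r + 1) * (1 + a * X)"
    using admissible_A_const_le[OF ad] by (simp add: a_def X_def)
  have "\<epsilon> / 2 * real m * real r ^ (k - 1) = \<epsilon> / 2 * (X * real r)"
    unfolding k1 power_Suc X_def by simp
  \<comment> \<open>Insert t \<ge> (a + \<epsilon>) X and A_r \<le> (r+1)(1 + a X): the terms a X r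
    cancel and \<epsilon> X r - (4a + 3\<epsilon>) X - (r+1) remains. With r + 1 \<le> 2X the loss
    is at most (4a + 3\<epsilon> + 2) X, and the threshold on r makes this at most half of
    \<epsilon> X r.\<close>
  also have "\<dots> \<le> real t * (real r - 3) - A_const k c r"
  proof -
    have "(a + \<epsilon>) * X * (real r - 3) \<le> real t * (real r - 3)"
      using tX r(1) by (intro mult_right_mono) auto
    moreover have "X * (2 * (4 * a + 3 * \<epsilon> + 2)) \<le> X * (\<epsilon> * real r)"
      using r\<epsilon> X by (intro mult_left_mono) auto
    moreover have "real r + 1 \<le> 2 * X" using X r(1) by simp
    ultimately show ?thesis using A by (simp add: algebra_simps)
  qed
  finally have "real q powr (\<epsilon> / 2 * real m * real r ^ (k - 1)) \<le>
      real q powr (real t * (real r - 3) - A_const k c r)"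
    using x by (intro powr_mono) auto
  also have "\<dots> = real q powr (real t * real r - A_const k c r - real t) / (real q powr 2) powr real t"
  proof -
    have "real t * (real r - 3) - A_const k c r =
        real t * real r - A_const k c r - real t - 2 * real t" by (simp add: algebra_simps)
    then show ?thesis by (simp only: powr_diff powr_powr)
  qed
  also have "\<dots> \<le> factorial_moment_null F k m (r + c) r t / mean_null F k m (r + c) r ^ t"
  proof (rule frac_le)
    show "real q powr (real t * real r - A_const k c r - real t) \<le>
        factorial_moment_null F k m (r + c) r t"
      by (rule factorial_moment_null_powr_ge[OF t2 t(2)])
    show "0 < mean_null F k m (r + c) r ^ t" using mean_null_critical(1) by simp
    have "2 * 2 \<le> real q * real q" using x by (intro mult_mono) auto
    then have "mean_null F k m (r + c) r \<le> (real q)\<^sup>2"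
      using mean_null_critical(2) by (simp add: power2_eq_square)
    then have "mean_null F k m (r + c) r ^ t \<le> ((real q)\<^sup>2) ^ t"
      using mean_null_critical(1) by (intro power_mono) auto
    then show "mean_null F k m (r + c) r ^ t \<le> (real q powr 2) powr real t"
      using x by (simp add: powr_realpow powr_numeral)
  qed (use factorial_moment_null_log_ge(1)[OF t2 t(2)] in simp)
  finally show ?thesis .
qed

end
end

text \<open>With w = (m+2)/2 one has A_r \<le> (r+1) w, so the exponent t r - A_r - t is at least (t
  - w) r - w - t, which grows linearly in r.\<close>

lemma factorial_moment_bilinear_unbounded:
  fixes m t :: nat
  assumes t: "real t > (real m + 2) / 2"
  shows "\<exists>R. \<forall>r\<ge>R. \<forall>(F :: nat ring) c. finite_field F \<and> admissible 2 r m c \<longrightarrow>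
    factorial_moment_null F 2 m (r + c) r t \<ge> B"
proof -
  define w where "w = (real m + 2) / 2"
  define d where "d = real t - w"
  have d: "d > 0" using t by (simp add: d_def w_def)
  \<comment> \<open>The bound 2t ensures t \<le> L_r/2 through r \<le> 2^r \<le> q^r. The other
    solves (t - w) r \<ge> log B + t + w for r; the logarithm to base 2 serves every q, and
    \<open>max 1 B\<close> keeps it nonnegative.\<close>
  define R where "R = max (2 * t) (nat \<lceil>(log 2 (max 1 B) + real t + w) / d\<rceil>)"
  show ?thesis
  proof (intro exI[of _ R] allI impI)
    fix r and F :: "nat ring" and c
    assume r: "r \<ge> R" and F: "finite_field F \<and> admissible 2 r m c"
    then interpret fin_field F by (simp add: finite_field_fin_field)
    have ad: "admissible 2 r m c" using F by simp
    note an = admissible_nat[OF ad]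
    have x: "real q \<ge> 2" using q_ge_2 by simp
    have t2: "t \<ge> 2" using t an(6) by simp
    have "2 * real t \<le> real r" using r by (simp add: R_def)
    also have "\<dots> \<le> 2 ^ r" using of_nat_less_two_power[of r] by (metis less_imp_le)
    also have "\<dots> \<le> real q ^ r" using x by (intro power_mono) auto
    also have "\<dots> \<le> L_const (real q) r" by (rule L_const_ge[OF x])
    finally have tL: "real t \<le> L_const (real q) r / 2" by simp
    have A: "A_const 2 c r \<le> (real r + 1) * w"
      using admissible_A_const_le[OF ad] by (simp add: w_def field_simps)
    have "(log 2 (max 1 B) + real t + w) / d \<le> real r"
      using r unfolding R_def by (simp add: le_nat_iff ceiling_le_iff nat_le_iff)
    then have "log 2 (max 1 B) + real t + w \<le> real r * d"
      using d by (simp add: pos_divide_le_eq)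
    then have E: "log 2 (max 1 B) \<le> real t * real r - A_const 2 c r - real t"
      using A by (simp add: d_def algebra_simps)
    have "B \<le> 2 powr (log 2 (max 1 B))" by simp
    also have "\<dots> \<le> real q powr (log 2 (max 1 B))"
      using x by (intro powr_mono2) auto
    also have "\<dots> \<le> real q powr (real t * real r - A_const 2 c r - real t)"
      using E x by (intro powr_mono) auto
    also have "\<dots> \<le> factorial_moment_null F 2 m (r + c) r t"
      by (rule factorial_moment_null_powr_ge[OF ad t2 tL])
    finally show "B \<le> factorial_moment_null F 2 m (r + c) r t" .
  qed
qed

text \<open>Since m r^(k-1) \<ge> r and q \<ge> 2, the power is at least 2^(\<epsilon> r/2), so one
  threshold serves all fields and all m.\<close>

lemma ratio_bound_unbounded:
  fixes k :: nat and \<epsilon> B :: real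
  assumes k: "k \<ge> 3" and \<epsilon>: "\<epsilon> > 0"
  shows "\<exists>R. \<forall>r\<ge>R. \<forall>(F :: nat ring) m c. finite_field F \<and> admissible k r m c \<longrightarrow>
    real (card (carrier F)) powr (\<epsilon> / 2 * real m * real r ^ (k - 1)) \<ge> B"
proof -
  define R where "R = nat \<lceil>2 * log 2 (max 1 B) / \<epsilon>\<rceil>"
  show ?thesis
  proof (intro exI[of _ R] allI impI)
    fix r and F :: "nat ring" and m c
    assume r: "r \<ge> R" and F: "finite_field F \<and> admissible k r m c"
    then interpret fin_field F by (simp add: finite_field_fin_field)
    have x: "real q \<ge> 2" using q_ge_2 by simp
    have ad: "admissible k r m c" using F by simp
    note an = admissible_nat[OF ad]
    have "2 * log 2 (max 1 B) / \<epsilon> \<le> real r"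
      using r unfolding R_def by (simp add: nat_le_iff ceiling_le_iff)
    then have "log 2 (max 1 B) \<le> \<epsilon> / 2 * real r"
      using \<epsilon> by (simp add: pos_divide_le_eq mult.commute)
    also have "\<dots> \<le> \<epsilon> / 2 * (real m * real r ^ (k - 1))"
    proof (rule mult_left_mono)
      have "real r ^ 1 \<le> real r ^ (k - 1)" using an k by (intro power_increasing) auto
      then have "1 * real r \<le> real m * real r ^ (k - 1)"
        using an(6) by (intro mult_mono) auto
      then show "real r \<le> real m * real r ^ (k - 1)" by simp
    qed (use \<epsilon> in simp)
    finally have E: "log 2 (max 1 B) \<le> \<epsilon> / 2 * real m * real r ^ (k - 1)"
      by (simp add: mult.assoc)
    have "B \<le> 2 powr (log 2 (max 1 B))" by simp
    also have "\<dots> \<le> real q powr (log 2 (max 1 B))"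
      using x by (intro powr_mono2) auto
    also have "\<dots> \<le> real q powr (\<epsilon> / 2 * real m * real r ^ (k - 1))"
      using E x by (intro powr_mono) auto
    finally show "B \<le> real q powr (\<epsilon> / 2 * real m * real r ^ (k - 1))" .
  qed
qed

text \<open>Each threshold \<open>R\<close> and the constant \<open>K\<close> precede the quantifier
  over fields, which expresses uniformity in q; divergence means exceeding every \<open>B\<close>
  from some \<open>R\<close> on. Positivity of the moment accompanies the logarithmic bound because
  \<open>log\<close> also has a value at nonpositive arguments.\<close>

theorem proposition6p11:
  shows
    "(\<forall>(F :: nat ring) k r m c.
        finite_field F \<and> admissible k r m c \<longrightarrow>
        mean_null F k m (r + c) (r + 1)
          \<le> C_const (real (card (carrier F))) * real (card (carrier F)) powr (- A_const k c r))
   \<and> (\<exists>K :: real. \<forall>(F :: nat ring) k r m c t.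
        finite_field F \<and> admissible k r m c \<and>
        2 \<le> t \<and> real t \<le> L_const (real (card (carrier F))) r / 2 \<longrightarrow>
        factorial_moment_null F k m (r + c) r t > 0 \<and>
        log (real (card (carrier F))) (factorial_moment_null F k m (r + c) r t)
          \<ge> real t * real r - A_const k c r - K * real t)
   \<and> (\<forall>m t :: nat. real t > (real m + 2) / 2 \<longrightarrow>
        (\<forall>B :: real. \<exists>R. \<forall>r\<ge>R. \<forall>(F :: nat ring) c.
           finite_field F \<and> admissible 2 r m c \<longrightarrow>
           factorial_moment_null F 2 m (r + c) r t \<ge> B))
   \<and> (\<forall>k\<ge>3. \<forall>\<epsilon>>0 :: real.
        (\<exists>R. \<forall>r\<ge>R. \<forall>(F :: nat ring) m c t.
           finite_field F \<and> admissible k r m c \<and>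
           real t \<ge> ((real k - 1) / fact k + \<epsilon>) * real m * real r ^ (k - 2) \<and>
           real t \<le> L_const (real (card (carrier F))) r / 2 \<longrightarrow>
           factorial_moment_null F k m (r + c) r t / mean_null F k m (r + c) r ^ t
             \<ge> real (card (carrier F)) powr (\<epsilon> / 2 * real m * real r ^ (k - 1))) \<and>
        (\<forall>B :: real. \<exists>R. \<forall>r\<ge>R. \<forall>(F :: nat ring) m c.
           finite_field F \<and> admissible k r m c \<longrightarrow>
           real (card (carrier F)) powr (\<epsilon> / 2 * real m * real r ^ (k - 1)) \<ge> B))"
proof (intro conjI allI impI)
  fix F :: "nat ring" and k r m c
  assume F: "finite_field F \<and> admissible k r m c"
  then interpret fin_field F by (simp add: finite_field_fin_field)
  show "mean_null F k m (r + c) (r + 1)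
      \<le> C_const (real (card (carrier F))) * real (card (carrier F)) powr (- A_const k c r)"
    using F by (intro mean_null_Suc_bounds(2)) simp
next
  show "\<exists>K :: real. \<forall>(F :: nat ring) k r m c t.
      finite_field F \<and> admissible k r m c \<and>
      2 \<le> t \<and> real t \<le> L_const (real (card (carrier F))) r / 2 \<longrightarrow>
      factorial_moment_null F k m (r + c) r t > 0 \<and>
      log (real (card (carrier F))) (factorial_moment_null F k m (r + c) r t)
        \<ge> real t * real r - A_const k c r - K * real t"
  \<comment> \<open>The implied constant is 1: one power of q per tuple entry is lost in L_r/2 \<ge>
    q^(r-1).\<close>
  proof (intro exI[of _ 1] allI impI)
    fix F :: "nat ring" and k r m c t
    assume F: "finite_field F \<and> admissible k r m c \<and>
      2 \<le> t \<and> real t \<le> L_const (real (card (carrier F))) r / 2"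
    then interpret fin_field F by (simp add: finite_field_fin_field)
    show "factorial_moment_null F k m (r + c) r t > 0 \<and>
        log (real (card (carrier F))) (factorial_moment_null F k m (r + c) r t)
          \<ge> real t * real r - A_const k c r - 1 * real t"
      using F factorial_moment_null_log_ge[of k r m c t] by simp
  qed
next
  fix m t :: nat and B :: real
  assume "real t > (real m + 2) / 2"
  then show "\<exists>R. \<forall>r\<ge>R. \<forall>(F :: nat ring) c. finite_field F \<and> admissible 2 r m c \<longrightarrow>
      factorial_moment_null F 2 m (r + c) r t \<ge> B"
    by (rule factorial_moment_bilinear_unbounded)
next
  fix k :: nat and \<epsilon> :: real
  assume k: "3 \<le> k" and \<epsilon>: "0 < \<epsilon>"
  define R where "R = max 3 (nat \<lceil>2 * (4 * ((real k - 1) / fact k) + 3 * \<epsilon> + 2) / \<epsilon>\<rceil>)"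
  show "\<exists>R. \<forall>r\<ge>R. \<forall>(F :: nat ring) m c t.
      finite_field F \<and> admissible k r m c \<and>
      real t \<ge> ((real k - 1) / fact k + \<epsilon>) * real m * real r ^ (k - 2) \<and>
      real t \<le> L_const (real (card (carrier F))) r / 2 \<longrightarrow>
      factorial_moment_null F k m (r + c) r t / mean_null F k m (r + c) r ^ t
        \<ge> real (card (carrier F)) powr (\<epsilon> / 2 * real m * real r ^ (k - 1))"
  proof (intro exI[of _ R] allI impI)
    fix r and F :: "nat ring" and m c t
    assume r: "R \<le> r" and F: "finite_field F \<and> admissible k r m c \<and>
      real t \<ge> ((real k - 1) / fact k + \<epsilon>) * real m * real r ^ (k - 2) \<and>
      real t \<le> L_const (real (card (carrier F))) r / 2"
    then interpret fin_field F by (simp add: finite_field_fin_field)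
    have "3 \<le> r" "2 * (4 * ((real k - 1) / fact k) + 3 * \<epsilon> + 2) / \<epsilon> \<le> real r"
      using r unfolding R_def by (simp_all add: nat_le_iff ceiling_le_iff)
    then show "factorial_moment_null F k m (r + c) r t / mean_null F k m (r + c) r ^ t
        \<ge> real (card (carrier F)) powr (\<epsilon> / 2 * real m * real r ^ (k - 1))"
      using F by (intro factorial_moment_ratio_ge k \<epsilon>) simp_all
  qed
next
  fix k :: nat and \<epsilon> B :: real
  assume "3 \<le> k" "0 < \<epsilon>"
  then show "\<exists>R. \<forall>r\<ge>R. \<forall>(F :: nat ring) m c. finite_field F \<and> admissible k r m c \<longrightarrow>
      real (card (carrier F)) powr (\<epsilon> / 2 * real m * real r ^ (k - 1)) \<ge> B"
    by (rule ratio_bound_unbounded)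
qed

end
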